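(* Let $\Bbbk$ be a field of characteristic zero. Each of the following subspaces $V\subseteq\Bbbk[x_1,x_2,x_3]_3$ has generic initial space, with respect to the reverse lexicographic order, $$\mathrm{gin}(V)=\langle x_1^3,\ x_1^2x_2,\ x_1x_2^2,\ x_1^2x_3\rangle .$$ (a) $V=\langle x_1q,\ x_2q,\ x_3q,\ p\rangle$, where $q$ is a nonzero quadratic form and $p$ is a cubic form not divisible by $q$. Moreover, if $p$ and $q$ are relatively prime, the vanishing locus of $V$ in $\mathbb{P}^2$ is the complete intersection of $p$ and $q$. (b) $V=\langle x_1(x_2^2+x_3^2),\ x_2(x_1^2+x_3^2),\ x_3(x_1^2+x_2^2),\ x_1x_2x_3\rangle$. The vanishing locus of $V$ in $\mathbb{P}^2$ consists of the three coordinate points $(1:0:0)$, $(0:1:0)$, $(0:0:1)$. (c) $V=\langle x_1^3+x_2^3+x_3^3,\ x_1^2x_2+x_2^2x_3+x_3^2x_1,\ x_1x_2^2+x_2x_3^2+x_3x_1^2,\ x_1x_2x_3\rangle$. The vanishing locus of $V$ in $\mathbb{P}^2$ is empty.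
   Context: Brackets $\langle\ldots\rangle$ denote linear span over $\Bbbk$. Reverse lexicographic order: for monomials of the same total degree, $x_1^{i_1}x_2^{i_2}x_3^{i_3}>x_1^{j_1}x_2^{j_2}x_3^{j_3}$ if for the largest index $r$ with $i_r\neq j_r$ one has $i_r<j_r$. For a linear subspace $W$ of homogeneous forms of a fixed degree, $\mathrm{in}(W)$ is the vector space spanned by the largest monomials of the nonzero elements of $W$. For $g$ in a suitable nonempty Zariski-open subset of $GL(\langle x_1,x_2,x_3\rangle)$, acting by linear change of coordinates, $\mathrm{in}(g.V)$ is constant; this common value is the generic initial space $\mathrm{gin}(V)$. The vanishing locus of $V$ is the common zero locus in $\mathbb{P}^2$ of the forms in $V$ (points taken over an algebraic closure of $\Bbbk$). *)

theory Defs
  imports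
    "HOL-Analysis.Determinants"
    "HOL-Library.Poly_Mapping"
    "HOL-Computational_Algebra.Polynomial"
    "HOL-Algebra.Algebraic_Closure_Type"
begin

section \<open>Polynomials\<close>

text \<open>
  A monomial in variables indexed by the finite type \<open>'v\<close> is its exponent vector in
  \<open>nat ^ 'v\<close>, and a polynomial is a finitely supported map from exponent vectors to
  coefficients, with the ring structure of \<^theory>\<open>HOL-Library.Poly_Mapping\<close>.  The ring
  in the variables \<open>x\<^sub>1, x\<^sub>2, x\<^sub>3\<close> is \<open>('k, 3) mpoly\<close>; the elements of the index type
  \<open>3\<close> are written \<open>1\<close>, \<open>2\<close>, \<open>3\<close>.
\<close>

type_synonym ('k, 'v) mpoly = "(nat ^ 'v) \<Rightarrow>\<^sub>0 'k"

definition Const :: "'k::comm_ring_1 \<Rightarrow> ('k, 'v::finite) mpoly"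
  where "Const c = Poly_Mapping.single 0 c"

definition Var :: "'v::finite \<Rightarrow> ('k::comm_ring_1, 'v) mpoly"
  where "Var i = Poly_Mapping.single (axis i 1) 1"

definition mdeg :: "nat ^ 'v::finite \<Rightarrow> nat"
  where "mdeg m = (\<Sum>i\<in>UNIV. m $ i)"

definition homogeneous :: "nat \<Rightarrow> ('k::zero, 'v::finite) mpoly \<Rightarrow> bool"
  where "homogeneous d f \<longleftrightarrow> (\<forall>m\<in>Poly_Mapping.keys f. mdeg m = d)"

text \<open>
  The image of \<open>f\<close> under the ring homomorphism that maps coefficients by \<open>h\<close> and
  sends the variable \<open>i\<close> to \<open>a i\<close>.
\<close>

definition eval_mpoly ::
    "('k::zero \<Rightarrow> 'r::comm_ring_1) \<Rightarrow> ('v::finite \<Rightarrow> 'r) \<Rightarrow> ('k, 'v) mpoly \<Rightarrow> 'r"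
  where "eval_mpoly h a f =
    (\<Sum>m\<in>Poly_Mapping.keys f. h (Poly_Mapping.lookup f m) * (\<Prod>i\<in>UNIV. a i ^ (m $ i)))"

definition smult_mpoly :: "'k::comm_ring_1 \<Rightarrow> ('k, 'v::finite) mpoly \<Rightarrow> ('k, 'v) mpoly"
  where "smult_mpoly c f = Const c * f"

interpretation mpoly: vector_space "smult_mpoly :: 'k::field \<Rightarrow> ('k, 'v::finite) mpoly \<Rightarrow> _"
  by unfold_locales
    (simp_all add: smult_mpoly_def Const_def algebra_simps single_add mult_single
      flip: mult.assoc)

text \<open>
  This is the literal condition of the library constant \<^const>\<open>coprime\<close>, which is only
  available in integral domains equipped with a division operation.
\<close>

definition relatively_prime :: "'a::comm_ring_1 \<Rightarrow> 'a \<Rightarrow> bool"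
  where "relatively_prime a b \<longleftrightarrow> (\<forall>c. c dvd a \<longrightarrow> c dvd b \<longrightarrow> c dvd 1)"


section \<open>Reverse lexicographic order and initial spaces\<close>

text \<open>
  The position \<open>r\<close> ranges over natural numbers because the built-in order of the type
  \<open>3\<close> is not \<open>1 < 2 < 3\<close> (there, \<open>3 = 0\<close> is the least element).
\<close>

definition revlex_gt :: "nat ^ 3 \<Rightarrow> nat ^ 3 \<Rightarrow> bool"
  where "revlex_gt i j \<longleftrightarrow> mdeg i = mdeg j \<and>
    (\<exists>r\<in>{1..3::nat}. i $ of_nat r < j $ of_nat r \<and>
      (\<forall>s\<in>{r<..3}. i $ of_nat s = j $ of_nat s))"

text \<open>Only meaningful for nonzero forms.\<close>

definition lead_mon :: "('k::zero, 3) mpoly \<Rightarrow> nat ^ 3"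
  where "lead_mon f = (THE m. m \<in> Poly_Mapping.keys f \<and>
    (\<forall>n\<in>Poly_Mapping.keys f. n \<noteq> m \<longrightarrow> revlex_gt m n))"

definition initial_space :: "('k::field, 3) mpoly set \<Rightarrow> ('k, 3) mpoly set"
  where "initial_space W =
    mpoly.span {Poly_Mapping.single (lead_mon f) 1 | f. f \<in> W \<and> f \<noteq> 0}"


section \<open>Generic initial spaces\<close>

text \<open>
  The matrix \<open>A\<close> is the element of \<open>GL(\<langle>x\<^sub>1, x\<^sub>2, x\<^sub>3\<rangle>)\<close> with
  \<open>x\<^sub>j \<mapsto> (\<Sum>i. A $ i $ j * x\<^sub>i)\<close>, and it acts on polynomials by substitution.
\<close>

definition lin_act :: "'k::comm_ring_1 ^ 'v ^ 'v::finite \<Rightarrow> ('k, 'v) mpoly \<Rightarrow> ('k, 'v) mpoly"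
  where "lin_act A f = eval_mpoly Const (\<lambda>j. \<Sum>i\<in>UNIV. Const (A $ i $ j) * Var i) f"

text \<open>
  The Zariski topology on \<open>GL\<close> is the one induced by polynomials in the matrix
  entries; inverting the determinant gives no further closed sets.
\<close>

definition zariski_open_GL :: "('k::field ^ 'v ^ 'v::finite) set \<Rightarrow> bool"
  where "zariski_open_GL U \<longleftrightarrow>
    (\<exists>S :: ('k, 'v \<times> 'v) mpoly set.
      U = {A. invertible A \<and> (\<exists>P\<in>S. eval_mpoly (\<lambda>c. c) (\<lambda>(i, j). A $ i $ j) P \<noteq> 0)})"

text \<open>\<open>has_gin V G\<close>: the generic initial space of \<open>V\<close> exists and is \<open>G\<close>.\<close>

definition has_gin :: "('k::field, 3) mpoly set \<Rightarrow> ('k, 3) mpoly set \<Rightarrow> bool"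
  where "has_gin V G \<longleftrightarrow>
    (\<exists>U. zariski_open_GL U \<and> U \<noteq> {} \<and> (\<forall>A\<in>U. initial_space (lin_act A ` V) = G))"

lemma eval_mpoly_line:
  fixes f :: "('k::field, 'v::finite) mpoly"
  shows "\<exists>r. \<forall>t. poly r t = eval_mpoly (\<lambda>c. c) (\<lambda>i. a i + t * d i) f"
proof -
  let ?r = "\<Sum>m\<in>Poly_Mapping.keys f.
    [:Poly_Mapping.lookup f m:] * (\<Prod>i\<in>UNIV. [:a i, d i:] ^ (m $ i))"
  have "poly ?r t = eval_mpoly (\<lambda>c. c) (\<lambda>i. a i + t * d i) f" for t
    by (simp add: eval_mpoly_def poly_sum poly_prod)
  then show ?thesis by blast
qed

lemma det_line:
  fixes A D :: "'k::field ^ 'v ^ 'v::finite"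
  shows "\<exists>r. \<forall>t. poly r t = det (\<chi> i j. A $ i $ j + t * D $ i $ j)"
proof -
  let ?r = "det (\<chi> i j. [:A $ i $ j, D $ i $ j:])"
  have "poly ?r t = det (\<chi> i j. A $ i $ j + t * D $ i $ j)" for t
    by (simp add: det_def poly_sum poly_prod of_int_poly)
  then show ?thesis by blast
qed

lemma zariski_open_GL_Int_nonempty:
  fixes U U' :: "('k::field_char_0 ^ 'v ^ 'v::finite) set"
  assumes "zariski_open_GL U" "U \<noteq> {}" "zariski_open_GL U'" "U' \<noteq> {}"
  shows "U \<inter> U' \<noteq> {}"
proof -
  let ?ev = "\<lambda>(A :: 'k ^ 'v ^ 'v) P. eval_mpoly (\<lambda>c. c) (\<lambda>(i, j). A $ i $ j) P"
  obtain S where S: "U = {A. invertible A \<and> (\<exists>P\<in>S. ?ev A P \<noteq> 0)}"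
    using assms(1) unfolding zariski_open_GL_def by blast
  obtain S' where S': "U' = {A. invertible A \<and> (\<exists>P\<in>S'. ?ev A P \<noteq> 0)}"
    using assms(3) unfolding zariski_open_GL_def by blast
  obtain A P where A: "invertible A" "P \<in> S" "?ev A P \<noteq> 0" using assms(2) S by blast
  obtain B Q where B: "Q \<in> S'" "?ev B Q \<noteq> 0" using assms(4) S' by blast
  define L where "L t = (\<chi> i j. A $ i $ j + t * (B - A) $ i $ j)" for t
  have L0: "L 0 = A" and L1: "L 1 = B" by (simp_all add: L_def vec_eq_iff)
  have line: "\<exists>r. \<forall>t. poly r t = ?ev (L t) R" for R
    using eval_mpoly_line[of "\<lambda>(i, j). A $ i $ j" "\<lambda>(i, j). (B - A) $ i $ j" R]
    by (simp add: L_def case_prod_unfold)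
  obtain rP where rP: "\<And>t. poly rP t = ?ev (L t) P" using line by blast
  obtain rQ where rQ: "\<And>t. poly rQ t = ?ev (L t) Q" using line by blast
  obtain rD where rD: "\<And>t. poly rD t = det (L t)"
    using det_line[of A "B - A"] unfolding L_def by blast
  have "rP \<noteq> 0" using rP[of 0] A L0 by auto
  moreover have "rQ \<noteq> 0" using rQ[of 1] B L1 by auto
  moreover have "rD \<noteq> 0" using rD[of 0] A L0 by (auto simp: invertible_det_nz)
  ultimately have "finite {t. poly (rP * rQ * rD) t = 0}" by (intro poly_roots_finite) simp
  then obtain t where "poly (rP * rQ * rD) t \<noteq> 0"
    using infinite_UNIV_char_0[where 'a='k] by (metis (mono_tags, lifting) UNIV_eq_I mem_Collect_eq)
  then have "?ev (L t) P \<noteq> 0" "?ev (L t) Q \<noteq> 0" "invertible (L t)"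
    by (simp_all add: rP rQ rD invertible_det_nz)
  then have "L t \<in> U \<inter> U'" using A(2) B(1) unfolding S S' by blast
  then show ?thesis by blast
qed

lemma has_gin_unique:
  fixes V :: "('k::field_char_0, 3) mpoly set"
  assumes "has_gin V G" "has_gin V G'"
  shows "G = G'"
  using assms zariski_open_GL_Int_nonempty unfolding has_gin_def by (metis Int_iff ex_in_conv)


section \<open>Vanishing loci\<close>

text \<open>The point of projective space with homogeneous coordinates \<open>v \<noteq> 0\<close>.\<close>

definition proj_point :: "'K::field ^ 'n::finite \<Rightarrow> ('K ^ 'n) set"
  where "proj_point v = {c *s v | c. c \<noteq> 0}"

text \<open>
  For \<open>V\<close> consisting of forms, vanishing at a projective point does not depend on the
  representative.
\<close>

definition vanishing_locus :: "('k::field, 3) mpoly set \<Rightarrow> ('k alg_closure ^ 3) set set"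
  where "vanishing_locus V =
    {proj_point v | v. v \<noteq> 0 \<and> (\<forall>f\<in>V. eval_mpoly to_ac (\<lambda>i. v $ i) f = 0)}"

text \<open>
  Two forms cut out a complete intersection in the projective plane if their common zero
  locus has codimension two, i.e. dimension zero: it is finite and nonempty.
\<close>

definition is_complete_intersection ::
    "('k alg_closure ^ 3) set set \<Rightarrow> ('k::field, 3) mpoly \<Rightarrow> ('k, 3) mpoly \<Rightarrow> bool"
  where "is_complete_intersection Z f g \<longleftrightarrow>
    Z = vanishing_locus {f, g} \<and> finite Z \<and> Z \<noteq> {}"

end

theory Submission
  imports Defs
begin

text \<open>
  Restricting a form to \<open>x\<^sub>3 = 0\<close> after a linear substitution \<open>A\<close> means restricting it to the line
  through the first two rows of \<open>A\<close>.  If a four-dimensional space of cubics contains \<open>l q\<close>, where \<open>l\<close>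
  is the equation of that line and \<open>q\<close> does not vanish at the first row, then \<open>l q\<close> contributes
  the initial monomial \<open>x\<^sub>1\<^sup>2x\<^sub>3\<close>; the other three monomials appear as soon as a \<open>3 \<times> 3\<close> minor of
  coefficients on the line is nonzero, and both conditions are polynomial in \<open>A\<close>.  In (b) and (c)
  the cofactor \<open>q\<close> of an arbitrary line is given explicitly: with \<open>l = a x\<^sub>1 + b x\<^sub>2 + c x\<^sub>3\<close> it is
  \<open>a x\<^sub>2x\<^sub>3 + b x\<^sub>1x\<^sub>3 + c x\<^sub>1x\<^sub>2\<close> in (b) and
  \<open>bc x\<^sub>1\<^sup>2 + ac x\<^sub>2\<^sup>2 + ab x\<^sub>3\<^sup>2 + (a\<^sup>2 + bc) x\<^sub>2x\<^sub>3 + (b\<^sup>2 + ac) x\<^sub>1x\<^sub>3 + (c\<^sup>2 + ab) x\<^sub>1x\<^sub>2\<close> in (c).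
  In (a) the minor is \<open>q\<^sup>3/2\<close> times a second directional derivative of \<open>p/q\<close>; if all of these vanish,
  \<open>p/q\<close> is affine and \<open>q\<close> divides \<open>p\<close>.  For the complete intersection, make \<open>q\<close> monic in \<open>x\<^sub>1\<close>: the
  common zeros lie over the zeros of the resultant, a binary sextic, and if it vanishes identically
  the remainder of \<open>p\<close> modulo \<open>q\<close> yields a common linear factor.
\<close>

no_notation fps_nth (infixl \<open>$\<close> 75)

section \<open>Evaluation homomorphisms\<close>

lemma poly_mapping_eq_sum_single:
  "f = (\<Sum>m\<in>Poly_Mapping.keys f. Poly_Mapping.single m (Poly_Mapping.lookup f m))"
  by (rule poly_mapping_eqI)
    (auto simp: lookup_sum lookup_single when_def in_keys_iff if_distrib sum.delta cong: if_cong)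

text \<open>Substitutions occur with the coefficient maps identity, \<open>Const\<close> and
  \<open>to_ac\<close>, and evaluations are again ring homomorphisms; the locale gives all of them
  one set of rules.\<close>

locale coeff_hom =
  fixes h :: "'k::comm_ring_1 \<Rightarrow> 'r::comm_ring_1"
  assumes hom_add: "h (a + b) = h a + h b"
    and hom_mult: "h (a * b) = h a * h b"
    and hom_one: "h 1 = 1"
begin

lemma hom_zero: "h 0 = 0"
  using hom_add[of 0 0] by simp

lemma hom_minus: "h (- a) = - h a"
  using hom_add[of a "- a"] by (simp add: hom_zero eq_neg_iff_add_eq_0 add.commute)

lemma hom_diff: "h (a - b) = h a - h b"
  using hom_add[of a "- b"] by (simp add: hom_minus)

lemma hom_sum: "h (\<Sum>i\<in>S. F i) = (\<Sum>i\<in>S. h (F i))"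
  by (induction S rule: infinite_finite_induct) (simp_all add: hom_zero hom_add)

lemma hom_prod: "h (\<Prod>i\<in>S. F i) = (\<Prod>i\<in>S. h (F i))"
  by (induction S rule: infinite_finite_induct) (simp_all add: hom_one hom_mult)

lemma hom_power: "h (a ^ n) = h a ^ n"
  by (induction n) (simp_all add: hom_one hom_mult)

text \<open>A common index set lets evaluations of polynomials with different supports be added
  termwise.\<close>

lemma eval_mpoly_superset:
  assumes "finite S" "Poly_Mapping.keys f \<subseteq> S"
  shows "eval_mpoly h a f = (\<Sum>m\<in>S. h (Poly_Mapping.lookup f m) * (\<Prod>i\<in>UNIV. a i ^ (m $ i)))"
  unfolding eval_mpoly_def using assms
  by (intro sum.mono_neutral_left) (auto simp: in_keys_iff hom_zero)

lemma eval_mpoly_single: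
  "eval_mpoly h a (Poly_Mapping.single m c) = h c * (\<Prod>i\<in>UNIV. a i ^ (m $ i))"
  by (subst eval_mpoly_superset[of "{m}"]) auto

lemma eval_mpoly_zero: "eval_mpoly h a 0 = 0"
  by (simp add: eval_mpoly_def)

lemma eval_mpoly_add: "eval_mpoly h a (f + g) = eval_mpoly h a f + eval_mpoly h a g"
proof -
  let ?S = "Poly_Mapping.keys f \<union> Poly_Mapping.keys g"
  have "Poly_Mapping.keys (f + g) \<subseteq> ?S" by (rule keys_add)
  then show ?thesis
    using eval_mpoly_superset[of ?S f a] eval_mpoly_superset[of ?S g a]
      eval_mpoly_superset[of ?S "f + g" a]
    by (simp add: lookup_add hom_add algebra_simps sum.distrib)
qed

lemma eval_mpoly_sum: "eval_mpoly h a (\<Sum>i\<in>S. F i) = (\<Sum>i\<in>S. eval_mpoly h a (F i))"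
  by (induction S rule: infinite_finite_induct) (simp_all add: eval_mpoly_zero eval_mpoly_add)

lemma eval_mpoly_mult: "eval_mpoly h a (f * g) = eval_mpoly h a f * eval_mpoly h a g"
proof -
  have fg: "f * g = (\<Sum>m\<in>Poly_Mapping.keys f. \<Sum>n\<in>Poly_Mapping.keys g.
    Poly_Mapping.single (m + n) (Poly_Mapping.lookup f m * Poly_Mapping.lookup g n))"
    by (subst poly_mapping_eq_sum_single[of f], subst poly_mapping_eq_sum_single[of g])
      (simp add: sum_product mult_single)
  show ?thesis
    unfolding fg
    by (simp add: eval_mpoly_sum eval_mpoly_single hom_mult power_add prod.distrib)
      (simp add: eval_mpoly_def sum_product algebra_simps)
qed

lemma eval_mpoly_Const: "eval_mpoly h a (Const c) = h c"
  by (simp add: Const_def eval_mpoly_single)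

lemma eval_mpoly_one: "eval_mpoly h a 1 = 1"
  using eval_mpoly_single[of a 0 1] by (simp add: hom_one)

lemma eval_mpoly_Var: "eval_mpoly h a (Var i) = a i"
proof -
  have "(\<Prod>j\<in>UNIV. a j ^ (axis i (1::nat) $ j)) = (\<Prod>j\<in>UNIV. if j = i then a j else 1)"
    by (intro prod.cong) (auto simp: axis_def)
  then show ?thesis by (simp add: Var_def eval_mpoly_single hom_one)
qed

lemma coeff_hom_eval: "coeff_hom (eval_mpoly h a)"
  by unfold_locales (simp_all add: eval_mpoly_add eval_mpoly_mult eval_mpoly_one)

lemma eval_mpoly_smult: "eval_mpoly h a (smult_mpoly c f) = h c * eval_mpoly h a f"
  by (simp add: smult_mpoly_def eval_mpoly_mult eval_mpoly_Const)

lemmas eval_mpoly_power = coeff_hom.hom_power[OF coeff_hom_eval]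
lemmas eval_mpoly_diff = coeff_hom.hom_diff[OF coeff_hom_eval]

lemmas eval_simps = eval_mpoly_add eval_mpoly_mult eval_mpoly_Const eval_mpoly_Var
  eval_mpoly_one eval_mpoly_zero eval_mpoly_power eval_mpoly_diff eval_mpoly_smult eval_mpoly_sum

end

text \<open>Evaluation uses ring operations only, so homomorphisms pass through it; this computes
  the values of substituted polynomials.\<close>

lemma hom_eval_mpoly:
  assumes "coeff_hom E"
  shows "E (eval_mpoly h a f) = eval_mpoly (\<lambda>c. E (h c)) (\<lambda>i. E (a i)) f"
proof -
  interpret E: coeff_hom E by fact
  show ?thesis
    by (simp add: eval_mpoly_def E.hom_sum E.hom_prod E.hom_power E.hom_mult)
qed

lemma coeff_hom_id: "coeff_hom (\<lambda>c. c)"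
  by unfold_locales auto

lemma coeff_hom_Const: "coeff_hom Const"
  by unfold_locales (simp_all add: Const_def single_add mult_single)

lemma coeff_hom_to_ac: "coeff_hom to_ac"
  by unfold_locales auto

interpretation id: coeff_hom "\<lambda>c. c" by (rule coeff_hom_id)
interpretation cn: coeff_hom Const by (rule coeff_hom_Const)
interpretation ac: coeff_hom to_ac by (rule coeff_hom_to_ac)

lemma eval_vanish_span:
  fixes S :: "('k::field, 'v::finite) mpoly set" and g :: "'k \<Rightarrow> 'r::comm_ring_1"
  assumes "coeff_hom g"
  shows "(\<forall>f\<in>mpoly.span S. eval_mpoly g a f = 0) \<longleftrightarrow> (\<forall>f\<in>S. eval_mpoly g a f = 0)"
proof -
  interpret g: coeff_hom g by fact
  have "eval_mpoly g a f = 0" if "f \<in> mpoly.span S" "\<forall>f\<in>S. eval_mpoly g a f = 0" for f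
    using that
    by (induction rule: mpoly.span_induct_alt) (auto simp: g.eval_simps)
  then show ?thesis using mpoly.span_base by blast
qed

text \<open>Substituting each variable for itself turns evaluation formulas into identities between
  polynomials.\<close>

lemma eval_Const_Var:
  fixes f :: "('a::comm_ring_1, 'b::finite) mpoly"
  shows "eval_mpoly Const Var f = f"
proof -
  have V: "(\<Prod>i\<in>S. (Var i :: ('a, 'b) mpoly) ^ (m $ i)) = Poly_Mapping.single (\<Sum>i\<in>S. axis i (m $ i)) 1"
    for m :: "nat ^ 'b" and S
  proof (induction S rule: infinite_finite_induct)
    case (insert i S)
    have "Var i ^ n = Poly_Mapping.single (axis i n) (1::'a)" for n
    proof (induction n)
      case 0
      have "axis i (0::nat) = 0" by (simp add: vec_eq_iff axis_def)
      then show ?case by (simp only: power_0 single_one)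
    next
      case (Suc n)
      have "axis i (Suc 0) + axis i n = axis i (Suc n)" by (simp add: vec_eq_iff axis_def)
      with Suc show ?case by (simp add: mult_single Var_def)
    qed
    with insert show ?case by (simp add: mult_single)
  qed auto
  have "(\<Sum>i\<in>UNIV. axis i (m $ i)) = m" for m :: "nat ^ 'b"
    by (simp add: vec_eq_iff axis_def if_distrib cong: if_cong)
  then have "Const c * (\<Prod>i\<in>UNIV. Var i ^ (m $ i)) = Poly_Mapping.single m c" for c :: 'a and m :: "nat ^ 'b"
    by (simp add: V Const_def mult_single)
  then show ?thesis
    by (simp add: eval_mpoly_def poly_mapping_eq_sum_single[symmetric])
qed

section \<open>Polynomials are determined by their values\<close>

lemma prod_UNIV_3: "(\<Prod>i\<in>UNIV. F i) = F 1 * F 2 * F (3::3)"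
  unfolding UNIV_3 by (simp add: ac_simps)

definition ev :: "'k::field ^ 3 \<Rightarrow> ('k, 3) mpoly \<Rightarrow> 'k"
  where "ev v f = eval_mpoly (\<lambda>c. c) (\<lambda>i. v $ i) f"

lemma ev_simps:
  "ev v (f + g) = ev v f + ev v g" "ev v (f - g) = ev v f - ev v g" "ev v (f * g) = ev v f * ev v g"
  "ev v (f ^ n) = ev v f ^ n" "ev v (Const c) = c" "ev v (Var i) = v $ i" "ev v 0 = 0" "ev v 1 = 1"
  "ev v (smult_mpoly c f) = c * ev v f" "ev v (\<Sum>i\<in>S. F i) = (\<Sum>i\<in>S. ev v (F i))"
  by (simp_all add: ev_def id.eval_simps)

lemma coeff_hom_ev: "coeff_hom (ev v)"
  by unfold_locales (simp_all add: ev_simps)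

text \<open>Kronecker substitution: for \<open>N\<close> larger than all exponents, x1 = t, x2 =
  t^N, x3 = t^(N^2) sends distinct monomials of \<open>f\<close> to distinct powers of t, and a
  univariate polynomial with infinitely many zeros vanishes. Taking t nonzero is enough, so callers
  may divide by coordinates.\<close>

lemma mpoly3_eq_0I:
  fixes f :: "('k::field_char_0, 3) mpoly"
  assumes "\<And>v :: 'k ^ 3. \<forall>i. v $ i \<noteq> 0 \<Longrightarrow> ev v f = 0"
  shows "f = 0"
proof (rule ccontr)
  assume "f \<noteq> 0"
  define N where "N = Suc (\<Sum>m\<in>Poly_Mapping.keys f. \<Sum>i\<in>UNIV. m $ i)"
  define e where "e m = m $ 1 + N * (m $ 2 + N * m $ 3)" for m :: "nat ^ 3"
  have bound: "m $ i < N" if "m \<in> Poly_Mapping.keys f" for m i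
  proof -
    have "m $ i \<le> (\<Sum>i\<in>UNIV. m $ i)" by (rule member_le_sum) auto
    also have "\<dots> \<le> (\<Sum>m\<in>Poly_Mapping.keys f. \<Sum>i\<in>UNIV. m $ i)"
      by (rule member_le_sum[of m _ "\<lambda>m. \<Sum>i\<in>UNIV. m $ i"]) (use that in auto)
    finally show ?thesis by (simp add: N_def)
  qed
  have "N \<noteq> 0" by (simp add: N_def)
  have inj: "m = n" if "m \<in> Poly_Mapping.keys f" "n \<in> Poly_Mapping.keys f" "e m = e n" for m n
  proof -
    \<comment> \<open>The exponents are the digits of \<open>e k\<close> in base
      \<open>N\<close>.\<close>
    have 1: "e k mod N = k $ 1" "e k div N mod N = k $ 2" "e k div N div N = k $ 3"
      if "k \<in> Poly_Mapping.keys f" for k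
      using bound[OF that] \<open>N \<noteq> 0\<close> by (simp_all add: e_def)
    show ?thesis
      using 1[OF that(1)] 1[OF that(2)] unfolding vec_eq_iff forall_3 that(3) by simp
  qed
  define r where "r = (\<Sum>m\<in>Poly_Mapping.keys f. monom (Poly_Mapping.lookup f m) (e m))"
  have "poly r t = 0" if "t \<noteq> 0" for t
  proof -
    have "t ^ e m = (\<Prod>i\<in>UNIV. (vector [t, t ^ N, t ^ (N * N)] :: 'k ^ 3) $ i ^ (m $ i))" for m
      by (simp only: e_def prod_UNIV_3 vector_3 power_add power_mult mult.assoc)
    then have "poly r t = ev (vector [t, t ^ N, t ^ (N * N)]) f"
      by (simp only: r_def ev_def eval_mpoly_def poly_sum poly_monom)
    also have "\<dots> = 0" using that by (intro assms) (simp add: forall_3)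
    finally show ?thesis .
  qed
  then have "UNIV \<subseteq> insert 0 {t. poly r t = 0}" by auto
  then have "infinite {t. poly r t = 0}"
    using infinite_UNIV_char_0[where 'a = 'k] by (meson finite_insert finite_subset)
  then have "r = 0" using poly_roots_finite[of r] by (cases "r = 0") simp_all
  moreover obtain m where m: "m \<in> Poly_Mapping.keys f" using \<open>f \<noteq> 0\<close>
    by (auto simp: poly_mapping_eq_iff fun_eq_iff in_keys_iff)
  have "coeff r (e m) = (\<Sum>n\<in>Poly_Mapping.keys f. if n = m then Poly_Mapping.lookup f m else 0)"
    unfolding r_def coeff_sum coeff_monom
  proof (rule sum.cong[OF refl])
    fix n assume "n \<in> Poly_Mapping.keys f"
    then have "e n = e m \<longleftrightarrow> n = m" using inj m by metis
    then show "(if e n = e m then Poly_Mapping.lookup f n else 0)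
      = (if n = m then Poly_Mapping.lookup f m else 0)" by simp
  qed
  with m have "coeff r (e m) \<noteq> 0" by (simp add: in_keys_iff)
  ultimately show False by simp
qed

lemma mpoly3_eqI:
  fixes f g :: "('k::field_char_0, 3) mpoly"
  assumes "\<And>v. \<forall>i. v $ i \<noteq> 0 \<Longrightarrow> ev v f = ev v g"
  shows "f = g"
proof -
  have "f - g = 0"
    by (rule mpoly3_eq_0I) (simp add: ev_simps assms)
  then show ?thesis by simp
qed

section \<open>Ternary quadratic and cubic forms\<close>

text \<open>A monomial of degree \<open>d\<close> is determined by its exponents \<open>i\<close> of
  x3 and \<open>j\<close> of x2.\<close>

lemma sum_mdeg_eq:
  fixes F :: "nat ^ 3 \<Rightarrow> 'a::comm_monoid_add"
  shows "finite {m :: nat ^ 3. mdeg m = d}"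
    and "(\<Sum>m | mdeg m = d. F m) = (\<Sum>i\<le>d. \<Sum>j\<le>d - i. F (vector [d - i - j, j, i]))"
proof -
  let ?S = "SIGMA i:{..d}. {..d - i}"
  have bij: "bij_betw (\<lambda>(i, j). vector [d - i - j, j, i] :: nat ^ 3) ?S {m. mdeg m = d}"
    by (rule bij_betwI[where g = "\<lambda>m. (m $ 3, m $ 2)"])
      (auto simp: mdeg_def sum_3 vec_eq_iff forall_3)
  then show "finite {m :: nat ^ 3. mdeg m = d}"
    using bij_betw_finite by fastforce
  show "(\<Sum>m | mdeg m = d. F m) = (\<Sum>i\<le>d. \<Sum>j\<le>d - i. F (vector [d - i - j, j, i]))"
    using sum.reindex_bij_betw[OF bij, of F] by (simp add: sum.Sigma case_prod_unfold)
qed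

lemma (in coeff_hom) eval_homogeneous:
  fixes f :: "('k, 3) mpoly"
  assumes "homogeneous d f"
  shows "eval_mpoly h a f = (\<Sum>i\<le>d. \<Sum>j\<le>d - i.
    h (Poly_Mapping.lookup f (vector [d - i - j, j, i])) * (a 1 ^ (d - i - j) * a 2 ^ j * a 3 ^ i))"
proof -
  have "Poly_Mapping.keys f \<subseteq> {m. mdeg m = d}" using assms by (auto simp: homogeneous_def)
  then show ?thesis
    by (simp only: eval_mpoly_superset[OF sum_mdeg_eq(1), of f d a] sum_mdeg_eq(2) prod_UNIV_3 vector_3)
qed

lemma sum_atMost_numeral:
  fixes F :: "nat \<Rightarrow> 'a::comm_monoid_add"
  shows "(\<Sum>i\<le>1. F i) = F 0 + F 1" "(\<Sum>i\<le>2. F i) = F 0 + F 1 + F 2"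
    "(\<Sum>i\<le>3. F i) = F 0 + F 1 + F 2 + F 3"
  by (simp_all add: numeral_2_eq_2 numeral_3_eq_3)

lemma (in coeff_hom) eval_quadratic:
  fixes f :: "('k, 3) mpoly"
  assumes "homogeneous 2 f"
  shows "eval_mpoly h a f = h (Poly_Mapping.lookup f (vector [2, 0, 0])) * a 1 ^ 2
    + h (Poly_Mapping.lookup f (vector [1, 1, 0])) * (a 1 * a 2)
    + h (Poly_Mapping.lookup f (vector [0, 2, 0])) * a 2 ^ 2
    + h (Poly_Mapping.lookup f (vector [1, 0, 1])) * (a 1 * a 3)
    + h (Poly_Mapping.lookup f (vector [0, 1, 1])) * (a 2 * a 3)
    + h (Poly_Mapping.lookup f (vector [0, 0, 2])) * a 3 ^ 2"
  unfolding eval_homogeneous[OF assms] by (simp add: sum_atMost_numeral)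

lemma (in coeff_hom) eval_cubic:
  fixes f :: "('k, 3) mpoly"
  assumes "homogeneous 3 f"
  shows "eval_mpoly h a f = h (Poly_Mapping.lookup f (vector [3, 0, 0])) * a 1 ^ 3
    + h (Poly_Mapping.lookup f (vector [2, 1, 0])) * (a 1 ^ 2 * a 2)
    + h (Poly_Mapping.lookup f (vector [1, 2, 0])) * (a 1 * a 2 ^ 2)
    + h (Poly_Mapping.lookup f (vector [0, 3, 0])) * a 2 ^ 3
    + h (Poly_Mapping.lookup f (vector [2, 0, 1])) * (a 1 ^ 2 * a 3)
    + h (Poly_Mapping.lookup f (vector [1, 1, 1])) * (a 1 * a 2 * a 3)
    + h (Poly_Mapping.lookup f (vector [0, 2, 1])) * (a 2 ^ 2 * a 3)
    + h (Poly_Mapping.lookup f (vector [1, 0, 2])) * (a 1 * a 3 ^ 2)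
    + h (Poly_Mapping.lookup f (vector [0, 1, 2])) * (a 2 * a 3 ^ 2)
    + h (Poly_Mapping.lookup f (vector [0, 0, 3])) * a 3 ^ 3"
  unfolding eval_homogeneous[OF assms] by (simp add: sum_atMost_numeral)

lemmas ev_quadratic = id.eval_quadratic[of f "\<lambda>i. v $ i" for f :: "('k::field, 3) mpoly" and v, folded ev_def]
lemmas ev_cubic = id.eval_cubic[of f "\<lambda>i. v $ i" for f :: "('k::field, 3) mpoly" and v, folded ev_def]

section \<open>Initial spaces of four-dimensional spaces of cubics\<close>

lemma revlex_gt_iff:
  "revlex_gt i j \<longleftrightarrow> mdeg i = mdeg j \<and>
    (i $ 3 < j $ 3 \<or> i $ 3 = j $ 3 \<and> (i $ 2 < j $ 2 \<or> i $ 2 = j $ 2 \<and> i $ 1 < j $ 1))"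
proof -
  have "{1..3::nat} = {1, 2, 3}" "{1<..3::nat} = {2, 3}" "{2<..3::nat} = {3}" "{3<..3::nat} = {}"
    by auto
  then show ?thesis by (auto simp: revlex_gt_def)
qed

lemma lead_mon_eqI:
  assumes "homogeneous d f" and "Poly_Mapping.lookup f m \<noteq> 0"
    and "\<And>n. mdeg n = d \<Longrightarrow> n \<noteq> m \<Longrightarrow> Poly_Mapping.lookup f n \<noteq> 0 \<Longrightarrow> revlex_gt m n"
  shows "lead_mon f = m"
  unfolding lead_mon_def
proof (rule the_equality)
  show max: "m \<in> Poly_Mapping.keys f \<and> (\<forall>n\<in>Poly_Mapping.keys f. n \<noteq> m \<longrightarrow> revlex_gt m n)"
    using assms by (auto simp: in_keys_iff homogeneous_def)
  fix m' assume "m' \<in> Poly_Mapping.keys f \<and> (\<forall>n\<in>Poly_Mapping.keys f. n \<noteq> m' \<longrightarrow> revlex_gt m' n)"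
  with max have "revlex_gt m m' \<and> revlex_gt m' m" if "m' \<noteq> m" using that by auto
  then show "m' = m" unfolding revlex_gt_iff by (cases "m' = m") auto
qed

text \<open>In decreasing order the cubic monomials begin x1^3, x1^2 x2, x1 x2^2, x2^3, x1^2 x3;
  each claim excludes its own monomial and those above it.\<close>

lemma revlex_gt_cubic:
  assumes "mdeg n = 3" "n \<noteq> vector [3, 0, 0]"
  shows "revlex_gt (vector [3, 0, 0]) n"
    and "n \<noteq> vector [2, 1, 0] \<Longrightarrow> revlex_gt (vector [2, 1, 0]) n"
    and "n \<noteq> vector [2, 1, 0] \<Longrightarrow> n \<noteq> vector [1, 2, 0] \<Longrightarrow> revlex_gt (vector [1, 2, 0]) n"
    and "n \<noteq> vector [2, 1, 0] \<Longrightarrow> n \<noteq> vector [1, 2, 0] \<Longrightarrow> n \<noteq> vector [0, 3, 0]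
      \<Longrightarrow> n \<noteq> vector [2, 0, 1] \<Longrightarrow> revlex_gt (vector [2, 0, 1]) n"
  using assms by (auto simp: revlex_gt_iff mdeg_def sum_3 vec_eq_iff forall_3)

lemma lookup_smult: "Poly_Mapping.lookup (smult_mpoly c f) m = c * Poly_Mapping.lookup f m"
proof -
  have "smult_mpoly c f = Poly_Mapping.map ((*) c) f"
    by (simp add: smult_mpoly_def Const_def mult_map_scale_conv_mult)
  then show ?thesis by (simp add: map.rep_eq when_def)
qed

abbreviation gin_cubics :: "('k::field, 3) mpoly set"
  where "gin_cubics \<equiv> {Poly_Mapping.single (vector [3, 0, 0]) 1, Poly_Mapping.single (vector [2, 1, 0]) 1,
    Poly_Mapping.single (vector [1, 2, 0]) 1, Poly_Mapping.single (vector [2, 0, 1]) 1}"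

lemma gin_cubics_eq:
  "gin_cubics = {Var 1 ^ 3, Var 1 ^ 2 * Var 2, Var 1 * Var 2 ^ 2, Var 1 ^ 2 * Var 3}"
proof -
  have "axis 1 1 + (axis 1 1 + axis 1 1) = (vector [3, 0, 0] :: nat ^ 3)"
    "axis 1 1 + axis 1 1 + axis 2 1 = (vector [2, 1, 0] :: nat ^ 3)"
    "axis 1 1 + (axis 2 1 + axis 2 1) = (vector [1, 2, 0] :: nat ^ 3)"
    "axis 1 1 + axis 1 1 + axis 3 1 = (vector [2, 0, 1] :: nat ^ 3)"
    by (simp_all add: vec_eq_iff forall_3 axis_def)
  then show ?thesis
    by (simp add: Var_def power3_eq_cube power2_eq_square mult_single mult.assoc add.assoc)
qed

text \<open>The forms \<open>h1\<close>, \<open>h2\<close>, \<open>h3\<close>, \<open>g\<close> are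
  in echelon form, hence independent and, by the bound on the dimension, a basis. The leading
  monomial of a combination is that of the first of them with nonzero coefficient.\<close>

lemma initial_space_eq_gin_triangular:
  fixes W T :: "('k::field, 3) mpoly set"
  assumes W: "mpoly.subspace W" "\<And>f. f \<in> W \<Longrightarrow> homogeneous 3 f"
    and T: "W \<subseteq> mpoly.span T" "finite T" "card T \<le> 4"
    and mem: "h1 \<in> W" "h2 \<in> W" "h3 \<in> W" "g \<in> W"
    and h1: "Poly_Mapping.lookup h1 (vector [3, 0, 0]) = 1"
      "Poly_Mapping.lookup h1 (vector [2, 1, 0]) = 0" "Poly_Mapping.lookup h1 (vector [1, 2, 0]) = 0"
    and h2: "Poly_Mapping.lookup h2 (vector [3, 0, 0]) = 0"
      "Poly_Mapping.lookup h2 (vector [2, 1, 0]) = 1" "Poly_Mapping.lookup h2 (vector [1, 2, 0]) = 0"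
    and h3: "Poly_Mapping.lookup h3 (vector [3, 0, 0]) = 0"
      "Poly_Mapping.lookup h3 (vector [2, 1, 0]) = 0" "Poly_Mapping.lookup h3 (vector [1, 2, 0]) = 1"
    and g: "Poly_Mapping.lookup g (vector [3, 0, 0]) = 0"
      "Poly_Mapping.lookup g (vector [2, 1, 0]) = 0" "Poly_Mapping.lookup g (vector [1, 2, 0]) = 0"
      "Poly_Mapping.lookup g (vector [0, 3, 0]) = 0" "Poly_Mapping.lookup g (vector [2, 0, 1]) \<noteq> 0"
  shows "initial_space W = mpoly.span gin_cubics"
proof -
  let ?K = "\<lambda>m. {f :: ('k, 3) mpoly. Poly_Mapping.lookup f m = 0}"
  have K: "mpoly.subspace (?K m)" for m
    by (auto simp: mpoly.subspace_def lookup_add lookup_smult)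
  have span_K: "Poly_Mapping.lookup f m = 0" if "f \<in> mpoly.span S" "S \<subseteq> ?K m" for f S m
    using mpoly.span_minimal[OF that(2) K] that(1) by auto
  have ne: "g \<noteq> 0" using g by auto
  \<comment> \<open>Independence: each of \<open>h3\<close>, \<open>h2\<close>, \<open>h1\<close>
    has coefficient 1 at a monomial where all later forms have coefficient 0.\<close>
  have n3: "h3 \<notin> mpoly.span {g}" using span_K[of h3 "{g}" "vector [1, 2, 0]"] g h3 by auto
  have n2: "h2 \<notin> mpoly.span {h3, g}" using span_K[of h2 "{h3, g}" "vector [2, 1, 0]"] g h2 h3 by auto
  have n1: "h1 \<notin> mpoly.span {h2, h3, g}"
    using span_K[of h1 "{h2, h3, g}" "vector [3, 0, 0]"] g h1 h2 h3 by auto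
  let ?B = "{h1, h2, h3, g}"
  have ind: "mpoly.independent ?B"
    using ne n1 n2 n3 by (intro mpoly.independent_insertI) (auto simp: mpoly.independent_empty)
  have "h1 \<notin> {h2, h3, g}" "h2 \<notin> {h3, g}" "h3 \<notin> {g}"
    using n1 n2 n3 mpoly.span_base[of h1 "{h2, h3, g}"] mpoly.span_base[of h2 "{h3, g}"]
      mpoly.span_base[of h3 "{g}"] by metis+
  then have card: "card ?B = 4" by simp
  have spanB: "W \<subseteq> mpoly.span ?B"
  proof
    fix f assume "f \<in> W"
    show "f \<in> mpoly.span ?B"
    proof (rule ccontr)
      \<comment> \<open>Otherwise five independent elements would lie in a space spanned by
        four.\<close>
      assume f: "f \<notin> mpoly.span ?B"
      then have "f \<notin> ?B" using mpoly.span_base[of f ?B] by metis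
      have "mpoly.independent (insert f ?B)" using f ind by (rule mpoly.independent_insertI)
      moreover have "insert f ?B \<subseteq> mpoly.span T"
        by (intro insert_subsetI empty_subsetI subsetD[OF T(1)] mem \<open>f \<in> W\<close>)
      ultimately have "card (insert f ?B) \<le> card T" using mpoly.independent_span_bound[OF T(2)] by metis
      with \<open>f \<notin> ?B\<close> card T(3) show False by (simp add: card_insert_if)
    qed
  qed
  have lead: "lead_mon f \<in> {vector [3, 0, 0], vector [2, 1, 0], vector [1, 2, 0], vector [2, 0, 1]}"
    if f: "f \<in> W" "f \<noteq> 0" for f
  proof -
    from f(1) spanB have "f \<in> mpoly.span ?B" by blast
    then obtain c1 c2 c3 c4 where
      "f - smult_mpoly c1 h1 - smult_mpoly c2 h2 - smult_mpoly c3 h3 - smult_mpoly c4 g = 0"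
      by (auto simp: mpoly.span_insert)
    then have feq: "f = smult_mpoly c1 h1 + smult_mpoly c2 h2 + smult_mpoly c3 h3 + smult_mpoly c4 g"
      by (simp add: algebra_simps)
    have l: "Poly_Mapping.lookup f (vector [3, 0, 0]) = c1" "Poly_Mapping.lookup f (vector [2, 1, 0]) = c2"
      "Poly_Mapping.lookup f (vector [1, 2, 0]) = c3"
      unfolding feq by (simp_all add: lookup_add lookup_smult h1 h2 h3 g del: One_nat_def)
    have hom: "homogeneous 3 f" using W(2) f(1) by blast
    consider "c1 \<noteq> 0" | "c1 = 0" "c2 \<noteq> 0" | "c1 = 0" "c2 = 0" "c3 \<noteq> 0" | "c1 = 0" "c2 = 0" "c3 = 0"
      by blast
    then show ?thesis
    proof cases
      case 1
      then have "lead_mon f = vector [3, 0, 0]"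
        using l by (intro lead_mon_eqI[OF hom] revlex_gt_cubic) auto
      then show ?thesis by simp
    next
      case 2
      then have "lead_mon f = vector [2, 1, 0]"
        using l by (intro lead_mon_eqI[OF hom] revlex_gt_cubic) auto
      then show ?thesis by simp
    next
      case 3
      then have "lead_mon f = vector [1, 2, 0]"
        using l by (intro lead_mon_eqI[OF hom] revlex_gt_cubic) auto
      then show ?thesis by simp
    next
      case 4
      then have f4: "f = smult_mpoly c4 g" using feq by simp
      with f(2) have "c4 \<noteq> 0" by auto
      with f4 g have "Poly_Mapping.lookup f (vector [2, 0, 1]) \<noteq> 0"
        "Poly_Mapping.lookup f (vector [0, 3, 0]) = 0" by (simp_all add: lookup_smult)
      with 4 l have "lead_mon f = vector [2, 0, 1]"
        by (intro lead_mon_eqI[OF hom] revlex_gt_cubic) auto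
      then show ?thesis by simp
    qed
  qed
  have nz: "h1 \<noteq> 0" "h2 \<noteq> 0" "h3 \<noteq> 0" using h1 h2 h3 by auto
  have lm: "lead_mon h1 = vector [3, 0, 0]" "lead_mon h2 = vector [2, 1, 0]"
    "lead_mon h3 = vector [1, 2, 0]" "lead_mon g = vector [2, 0, 1]"
    subgoal using h1 by (intro lead_mon_eqI[OF W(2)[OF mem(1)]] revlex_gt_cubic) auto
    subgoal using h2 by (intro lead_mon_eqI[OF W(2)[OF mem(2)]] revlex_gt_cubic) auto
    subgoal using h3 by (intro lead_mon_eqI[OF W(2)[OF mem(3)]] revlex_gt_cubic) auto
    subgoal using g by (intro lead_mon_eqI[OF W(2)[OF mem(4)]] revlex_gt_cubic) auto
    done
  have "Poly_Mapping.single (lead_mon h) (1 :: 'k) \<in> {Poly_Mapping.single (lead_mon f) (1 :: 'k) | f. f \<in> W \<and> f \<noteq> 0}"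
    if "h \<in> W" "h \<noteq> 0" for h :: "('k, 3) mpoly"
    using that by blast
  from this[OF mem(1) nz(1)] this[OF mem(2) nz(2)] this[OF mem(3) nz(3)] this[OF mem(4) ne]
  have "gin_cubics \<subseteq> {Poly_Mapping.single (lead_mon f) (1 :: 'k) | f. f \<in> W \<and> f \<noteq> 0}"
    unfolding lm by (intro insert_subsetI empty_subsetI)
  moreover have "{Poly_Mapping.single (lead_mon f) (1 :: 'k) | f. f \<in> W \<and> f \<noteq> 0} \<subseteq> gin_cubics"
  proof (rule subsetI)
    fix x :: "('k, 3) mpoly"
    assume "x \<in> {Poly_Mapping.single (lead_mon f) (1 :: 'k) | f. f \<in> W \<and> f \<noteq> 0}"
    then obtain f where f: "x = Poly_Mapping.single (lead_mon f) 1" "f \<in> W" "f \<noteq> 0" by blast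
    from lead[OF f(2,3)] show "x \<in> gin_cubics" unfolding f(1) by (elim insertE) simp_all
  qed
  ultimately have "{Poly_Mapping.single (lead_mon f) (1 :: 'k) | f. f \<in> W \<and> f \<noteq> 0} = gin_cubics" by blast
  then show ?thesis unfolding initial_space_def by simp
qed

text \<open>The inverse \<open>N\<close> of the coefficient matrix row-reduces the three forms
  \<open>f i\<close> to the echelon shape of the triangular case.\<close>

lemma initial_space_eq_gin:
  fixes W T :: "('k::field, 3) mpoly set" and f :: "3 \<Rightarrow> ('k, 3) mpoly"
  defines "e \<equiv> (vector [vector [3, 0, 0], vector [2, 1, 0], vector [1, 2, 0]] :: (nat ^ 3) ^ 3)"
  assumes W: "mpoly.subspace W" "\<And>f. f \<in> W \<Longrightarrow> homogeneous 3 f"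
    and T: "W \<subseteq> mpoly.span T" "finite T" "card T \<le> 4"
    and f: "\<And>i. f i \<in> W" "det (\<chi> i j. Poly_Mapping.lookup (f i) (e $ j)) \<noteq> 0"
    and g: "g \<in> W" "\<And>j. Poly_Mapping.lookup g (e $ j) = 0"
      "Poly_Mapping.lookup g (vector [0, 3, 0]) = 0" "Poly_Mapping.lookup g (vector [2, 0, 1]) \<noteq> 0"
  shows "initial_space W = mpoly.span gin_cubics"
proof -
  let ?M = "\<chi> i j. Poly_Mapping.lookup (f i) (e $ j)"
  obtain N where N: "N ** ?M = mat 1"
    using f(2) invertible_det_nz[of ?M] unfolding invertible_def by blast
  define h where "h i = (\<Sum>j\<in>UNIV. smult_mpoly (N $ i $ j) (f j))" for i
  have hW: "h i \<in> W" for i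
    unfolding h_def by (intro mpoly.subspace_sum mpoly.subspace_scale W(1) f(1))
  have look: "Poly_Mapping.lookup (h i) (e $ k) = (if i = k then 1 else 0)" for i k
  proof -
    have "Poly_Mapping.lookup (h i) (e $ k) = (N ** ?M) $ i $ k"
      by (simp add: h_def lookup_sum lookup_smult matrix_matrix_mult_def)
    then show ?thesis by (simp add: N mat_def)
  qed
  have e: "e $ 1 = vector [3, 0, 0]" "e $ 2 = vector [2, 1, 0]" "e $ 3 = vector [1, 2, 0]"
    by (simp_all add: e_def)
  have ne: "(1::3) \<noteq> 2" "(1::3) \<noteq> 3" "(2::3) \<noteq> 3" "(2::3) \<noteq> 1" "(3::3) \<noteq> 1" "(3::3) \<noteq> 2" by simp_all
  note l = look[of _ 1, unfolded e] look[of _ 2, unfolded e] look[of _ 3, unfolded e]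
  note l' = l[of 1, simplified ne if_True if_False refl] l[of 2, simplified ne if_True if_False refl]
    l[of 3, simplified ne if_True if_False refl]
  show ?thesis
    by (rule initial_space_eq_gin_triangular[OF W T hW[of 1] hW[of 2] hW[of 3] g(1)])
      (assumption | rule l' g(2)[of 1, unfolded e] g(2)[of 2, unfolded e] g(2)[of 3, unfolded e] g(3,4))+
qed

section \<open>Linear substitutions\<close>

lemma (in coeff_hom) eval_lin_act:
  "eval_mpoly h a (lin_act A f) = eval_mpoly h (\<lambda>j. \<Sum>i\<in>UNIV. h (A $ i $ j) * a i) f"
  unfolding lin_act_def hom_eval_mpoly[OF coeff_hom_eval[of a]] by (simp add: eval_simps)

text \<open>Points are row vectors, so the coordinate points go to the rows of \<open>A\<close>, and
  x3 = 0 goes to the span of the first two rows.\<close>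

lemma ev_lin_act: "ev u (lin_act A f) = ev (u v* A) f"
  by (simp add: ev_def id.eval_lin_act vector_matrix_mult_def mult.commute)

lemma vector3_vector_matrix_mult:
  "vector [s, t, u] v* (A :: 'k::field ^ 3 ^ 3) = s *s A $ 1 + t *s A $ 2 + u *s A $ 3"
  by (simp add: vec_eq_iff vector_matrix_mult_def sum_3 mult.commute)

lemma ev_vector3_lin_act:
  "ev (vector [s, t, u]) (lin_act A f) = ev (s *s A $ 1 + t *s A $ 2 + u *s A $ 3) f"
  by (simp only: ev_lin_act vector3_vector_matrix_mult)

lemma homogeneous_add: "homogeneous d f \<Longrightarrow> homogeneous d g \<Longrightarrow> homogeneous d (f + g)"
  using keys_add[of f g] by (auto simp: homogeneous_def)

lemma homogeneous_0: "homogeneous d 0"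
  by (simp add: homogeneous_def)

lemma homogeneous_sum:
  fixes F :: "'i \<Rightarrow> ('k::comm_ring_1, 'v::finite) mpoly"
  shows "(\<And>i. i \<in> S \<Longrightarrow> homogeneous d (F i)) \<Longrightarrow> homogeneous d (\<Sum>i\<in>S. F i)"
  by (induction S rule: infinite_finite_induct) (auto simp: homogeneous_0 homogeneous_add)

lemma mdeg_add: "mdeg (m + n) = mdeg m + mdeg n"
  by (simp add: mdeg_def sum.distrib)

lemma homogeneous_mult:
  fixes f g :: "('k::comm_ring_1, 'v::finite) mpoly"
  shows "homogeneous d f \<Longrightarrow> homogeneous e g \<Longrightarrow> homogeneous (d + e) (f * g)"
  using keys_mult[of f g] by (fastforce simp: homogeneous_def mdeg_add)

lemma homogeneous_Const: "homogeneous 0 (Const c)"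
  by (auto simp: homogeneous_def Const_def mdeg_def split: if_splits)

lemma homogeneous_one: "homogeneous 0 (1 :: ('k::comm_ring_1, 'v::finite) mpoly)"
  using homogeneous_Const[of 1] by (simp add: Const_def)

lemma mdeg_axis: "mdeg (axis i n) = n"
  by (simp add: mdeg_def axis_def)

lemma homogeneous_Var: "homogeneous 1 (Var i :: ('k::comm_ring_1, 'v::finite) mpoly)"
  by (auto simp: homogeneous_def Var_def mdeg_axis split: if_splits)

lemma homogeneous_smult: "homogeneous d f \<Longrightarrow> homogeneous d (smult_mpoly c f)"
  using homogeneous_mult[OF homogeneous_Const] by (fastforce simp: smult_mpoly_def)

lemma homogeneous_power:
  fixes f :: "('k::comm_ring_1, 'v::finite) mpoly"
  shows "homogeneous d f \<Longrightarrow> homogeneous (d * n) (f ^ n)"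
  by (induction n) (auto simp: homogeneous_one homogeneous_mult)

lemma homogeneous_prod:
  fixes F :: "'i \<Rightarrow> ('k::comm_ring_1, 'v::finite) mpoly"
  shows "(\<And>i. i \<in> S \<Longrightarrow> homogeneous (d i) (F i)) \<Longrightarrow> homogeneous (\<Sum>i\<in>S. d i) (\<Prod>i\<in>S. F i)"
  by (induction S rule: infinite_finite_induct) (auto simp: homogeneous_one homogeneous_mult)

lemma homogeneous_linear_sum:
  "homogeneous 1 (\<Sum>i\<in>UNIV. Const (c i) * Var i :: ('k::comm_ring_1, 'v::finite) mpoly)"
  using homogeneous_mult[OF homogeneous_Const homogeneous_Var] by (intro homogeneous_sum) fastforce

lemma homogeneous_lin_act:
  assumes "homogeneous d f"
  shows "homogeneous d (lin_act A f)"
  unfolding lin_act_def eval_mpoly_def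
proof (rule homogeneous_sum)
  fix m assume "m \<in> Poly_Mapping.keys f"
  then have "mdeg m = d" using assms by (simp add: homogeneous_def)
  moreover have "homogeneous (\<Sum>i\<in>UNIV. 1 * m $ i)
      (\<Prod>i\<in>UNIV. (\<Sum>k\<in>UNIV. Const (A $ k $ i) * Var k) ^ (m $ i))"
    by (intro homogeneous_prod homogeneous_power homogeneous_linear_sum)
  ultimately show "homogeneous d (Const (Poly_Mapping.lookup f m) *
      (\<Prod>i\<in>UNIV. (\<Sum>k\<in>UNIV. Const (A $ k $ i) * Var k) ^ (m $ i)))"
    using homogeneous_mult[OF homogeneous_Const] by (fastforce simp: mdeg_def)
qed

lemma homogeneous_span:
  assumes "f \<in> mpoly.span S" "\<And>s. s \<in> S \<Longrightarrow> homogeneous d s"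
  shows "homogeneous d f"
  using assms(1)
  by (induction rule: mpoly.span_induct_alt) (auto simp: homogeneous_0 homogeneous_add homogeneous_smult assms)

lemma module_hom_lin_act: "module_hom smult_mpoly smult_mpoly (lin_act (A :: 'k::field ^ 'v ^ 'v::finite))"
  by unfold_locales (simp_all add: lin_act_def cn.eval_mpoly_add cn.eval_mpoly_smult smult_mpoly_def
      cn.eval_mpoly_mult cn.eval_mpoly_Const)

lemma (in coeff_hom) eval_linear:
  fixes f :: "('k, 3) mpoly"
  assumes "homogeneous 1 f"
  shows "eval_mpoly h a f = h (Poly_Mapping.lookup f (vector [1, 0, 0])) * a 1
    + h (Poly_Mapping.lookup f (vector [0, 1, 0])) * a 2
    + h (Poly_Mapping.lookup f (vector [0, 0, 1])) * a 3"
  unfolding eval_homogeneous[OF assms] by (simp add: sum_atMost_numeral)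

lemmas ev_linear = id.eval_linear[of f "\<lambda>i. v $ i" for f :: "('k::field, 3) mpoly" and v, folded ev_def]

text \<open>Interpolation on a coordinate line: half the sum and half the difference of the values
  at (1,1) and (1,-1) separate even from odd powers of the second variable.\<close>

lemma lookup_cubic:
  fixes f :: "('k::field_char_0, 3) mpoly"
  assumes "homogeneous 3 f"
  shows "Poly_Mapping.lookup f (vector [3, 0, 0]) = ev (vector [1, 0, 0]) f"
    and "Poly_Mapping.lookup f (vector [2, 1, 0]) =
      (ev (vector [1, 1, 0]) f - ev (vector [1, -1, 0]) f) / 2 - ev (vector [0, 1, 0]) f"
    and "Poly_Mapping.lookup f (vector [1, 2, 0]) =
      (ev (vector [1, 1, 0]) f + ev (vector [1, -1, 0]) f) / 2 - ev (vector [1, 0, 0]) f"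
    and "Poly_Mapping.lookup f (vector [0, 3, 0]) = ev (vector [0, 1, 0]) f"
    and "Poly_Mapping.lookup f (vector [2, 0, 1]) =
      (ev (vector [1, 0, 1]) f - ev (vector [1, 0, -1]) f) / 2 - ev (vector [0, 0, 1]) f"
  by (simp_all add: ev_cubic[OF assms] field_simps)

text \<open>
  The coefficients of \<open>s\<^sup>3\<close>, \<open>s\<^sup>2t\<close> and \<open>st\<^sup>2\<close> in the binary cubic \<open>f (s a + t v)\<close>, obtained by
  interpolation so that they are visibly polynomial in \<open>a\<close> and \<open>v\<close>.
\<close>

definition line_coeffs :: "('k::field, 3) mpoly \<Rightarrow> 'k ^ 3 \<Rightarrow> 'k ^ 3 \<Rightarrow> 'k ^ 3"
  where "line_coeffs f a v = vector [ev a f, (ev (a + v) f - ev (a - v) f) / 2 - ev v f,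
    (ev (a + v) f + ev (a - v) f) / 2 - ev a f]"

text \<open>Since \<open>l\<close> vanishes on the first two rows, substitution turns it into a
  nonzero multiple of x3. So \<open>l * q\<close> becomes x3 times a multiple of the substituted
  \<open>q\<close>, whose x1^2 coefficient is \<open>ev (A $ 1) q\<close>; this is the form with
  leading monomial x1^2 x3.\<close>

lemma initial_space_lin_act_eq_gin:
  fixes T :: "('k::field_char_0, 3) mpoly set" and f :: "3 \<Rightarrow> ('k, 3) mpoly"
  assumes T: "finite T" "card T \<le> 4" "\<And>t. t \<in> T \<Longrightarrow> homogeneous 3 t"
    and f: "\<And>i. f i \<in> mpoly.span T" "det (\<chi> i. line_coeffs (f i) (A $ 1) (A $ 2)) \<noteq> 0"
    and lq: "homogeneous 1 l" "homogeneous 2 q" "l * q \<in> mpoly.span T"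
    and l: "ev (A $ 1) l = 0" "ev (A $ 2) l = 0" "ev (A $ 3) l \<noteq> 0"
    and q: "ev (A $ 1) q \<noteq> 0"
  shows "initial_space (lin_act A ` mpoly.span T) = mpoly.span gin_cubics"
proof -
  interpret lin: module_hom smult_mpoly smult_mpoly "lin_act A" by (rule module_hom_lin_act)
  let ?W = "lin_act A ` mpoly.span T" and ?g = "lin_act A (l * q)"
  have hom: "homogeneous 3 g" if "g \<in> ?W" for g
    using that homogeneous_span[OF _ T(3)] homogeneous_lin_act by blast
  have "?W = mpoly.span (lin_act A ` T)" by (rule lin.span_image[symmetric])
  then have W: "mpoly.subspace ?W" "?W \<subseteq> mpoly.span (lin_act A ` T)"
    using mpoly.subspace_span by auto
  have card: "finite (lin_act A ` T)" "card (lin_act A ` T) \<le> 4"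
    using T(1,2) card_image_le[of T "lin_act A"] by auto
  let ?e = "vector [vector [3, 0, 0], vector [2, 1, 0], vector [1, 2, 0]] :: (nat ^ 3) ^ 3"
  have "Poly_Mapping.lookup (lin_act A (f i)) (?e $ j) = line_coeffs (f i) (A $ 1) (A $ 2) $ j" for i j
  proof -
    have "homogeneous 3 (lin_act A (f i))" using f(1) hom by blast
    note c = lookup_cubic[OF this]
    consider "j = 1" | "j = 2" | "j = 3" using exhaust_3 by blast
    then show ?thesis
      by cases (simp_all only: vector_3 c ev_vector3_lin_act line_coeffs_def, simp_all)
  qed
  then have det: "det (\<chi> i j. Poly_Mapping.lookup (lin_act A (f i)) (?e $ j)) \<noteq> 0"
    using f(2) by (simp add: vec_lambda_eta)
  have g: "ev (vector [s, t, u]) ?g = u * ev (A $ 3) l * ev (vector [s, t, u]) (lin_act A q)" for s t u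
  proof -
    have "ev (s *s A $ 1 + t *s A $ 2 + u *s A $ 3) l
        = s * ev (A $ 1) l + t * ev (A $ 2) l + u * ev (A $ 3) l"
      by (simp add: ev_linear[OF lq(1)] algebra_simps)
    then show ?thesis by (simp only: ev_vector3_lin_act ev_simps l) simp
  qed
  have "?g \<in> ?W" using lq(3) by blast
  note c = lookup_cubic[OF hom[OF this]]
  have "Poly_Mapping.lookup ?g (vector [2, 0, 1]) = ev (A $ 3) l * ev (vector [1, 0, 0]) (lin_act A q)"
    using ev_quadratic[OF homogeneous_lin_act[OF lq(2)]] unfolding c g by (simp add: field_simps)
  also have "\<dots> \<noteq> 0" using l(3) q by (simp only: ev_vector3_lin_act) simp
  finally have g201: "Poly_Mapping.lookup ?g (vector [2, 0, 1]) \<noteq> 0" .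
  have g030: "Poly_Mapping.lookup ?g (vector [0, 3, 0]) = 0" unfolding c g by simp
  have ge: "Poly_Mapping.lookup ?g (?e $ j) = 0" for j
  proof -
    consider "j = 1" | "j = 2" | "j = 3" using exhaust_3 by blast
    then show ?thesis by cases (simp_all only: vector_3 c g, simp_all)
  qed
  show ?thesis
    by (rule initial_space_eq_gin[OF W(1) hom W(2) card, of "\<lambda>i. lin_act A (f i)" ?g])
      (use f(1) det \<open>?g \<in> ?W\<close> ge g030 g201 in \<open>simp_all del: One_nat_def\<close>)
qed

section \<open>Polynomial functions of a matrix\<close>

text \<open>These functions define the Zariski open sets; closure rules avoid writing polynomials in
  the nine entries.\<close>

definition matrix_poly :: "('k::field ^ 3 ^ 3 \<Rightarrow> 'k) \<Rightarrow> bool"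
  where "matrix_poly F \<longleftrightarrow> (\<exists>P. \<forall>A. F A = eval_mpoly (\<lambda>c. c) (\<lambda>(i, j). A $ i $ j) P)"

lemma matrix_poly_const: "matrix_poly (\<lambda>A. c)"
  unfolding matrix_poly_def by (rule exI[of _ "Const c"]) (simp add: id.eval_mpoly_Const)

lemma matrix_poly_entry: "matrix_poly (\<lambda>A. A $ i $ j)"
  unfolding matrix_poly_def by (rule exI[of _ "Var (i, j)"]) (simp add: id.eval_mpoly_Var)

lemma matrix_poly_add: "matrix_poly F \<Longrightarrow> matrix_poly G \<Longrightarrow> matrix_poly (\<lambda>A. F A + G A)"
  unfolding matrix_poly_def by (metis id.eval_mpoly_add)

lemma matrix_poly_diff: "matrix_poly F \<Longrightarrow> matrix_poly G \<Longrightarrow> matrix_poly (\<lambda>A. F A - G A)"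
  unfolding matrix_poly_def by (metis id.eval_mpoly_diff)

lemma matrix_poly_mult: "matrix_poly F \<Longrightarrow> matrix_poly G \<Longrightarrow> matrix_poly (\<lambda>A. F A * G A)"
  unfolding matrix_poly_def by (metis id.eval_mpoly_mult)

lemma matrix_poly_divide_const: "matrix_poly F \<Longrightarrow> matrix_poly (\<lambda>A. F A / c)"
  using matrix_poly_mult[OF _ matrix_poly_const[of "inverse c"]] by (simp add: field_class.field_divide_inverse)

lemma matrix_poly_power: "matrix_poly F \<Longrightarrow> matrix_poly (\<lambda>A. F A ^ n)"
  unfolding matrix_poly_def by (metis id.eval_mpoly_power)

lemma matrix_poly_sum:
  "(\<And>i. i \<in> S \<Longrightarrow> matrix_poly (F i)) \<Longrightarrow> matrix_poly (\<lambda>A. \<Sum>i\<in>S. F i A)"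
  by (induction S rule: infinite_finite_induct) (auto intro: matrix_poly_const matrix_poly_add)

lemma matrix_poly_prod:
  "(\<And>i. i \<in> S \<Longrightarrow> matrix_poly (F i)) \<Longrightarrow> matrix_poly (\<lambda>A. \<Prod>i\<in>S. F i A)"
  by (induction S rule: infinite_finite_induct) (auto intro: matrix_poly_const matrix_poly_mult)

lemma matrix_poly_ev: "(\<And>i. matrix_poly (\<lambda>A. v A $ i)) \<Longrightarrow> matrix_poly (\<lambda>A. ev (v A) f)"
  unfolding ev_def eval_mpoly_def
  by (intro matrix_poly_sum matrix_poly_mult matrix_poly_const matrix_poly_prod matrix_poly_power)

lemma matrix_poly_line_coeffs: "matrix_poly (\<lambda>A. line_coeffs f (A $ i) (A $ j) $ k)"
proof -
  have 1: "matrix_poly (\<lambda>A. ev (A $ i) f)" for i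
    by (intro matrix_poly_ev matrix_poly_entry)
  have 2: "matrix_poly (\<lambda>A. ev (A $ i + A $ j) f)"
    by (rule matrix_poly_ev) (simp add: matrix_poly_add matrix_poly_entry)
  have 3: "matrix_poly (\<lambda>A. ev (A $ i - A $ j) f)"
    by (rule matrix_poly_ev) (simp add: matrix_poly_diff matrix_poly_entry)
  consider "k = 1" | "k = 2" | "k = 3" using exhaust_3 by blast
  then show ?thesis
    by cases (simp_all only: line_coeffs_def vector_3,
        (intro matrix_poly_add matrix_poly_diff matrix_poly_divide_const 1 2 3)+)
qed

lemma matrix_poly_det:
  assumes "\<And>i j. matrix_poly (\<lambda>A. M A $ i $ j)"
  shows "matrix_poly (\<lambda>A. det (M A :: 'k::field ^ 3 ^ 3))"
  unfolding det_3 by (intro matrix_poly_add matrix_poly_diff matrix_poly_mult assms)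

text \<open>The open set is the principal one where \<open>F\<close> is nonzero; the single matrix
  \<open>A\<close> shows that it is nonempty.\<close>

lemma has_ginI:
  assumes F: "matrix_poly F" and A: "invertible A" "F A \<noteq> 0"
    and eq: "\<And>A. invertible A \<Longrightarrow> F A \<noteq> 0 \<Longrightarrow> initial_space (lin_act A ` V) = G"
  shows "has_gin V G"
proof -
  obtain P where P: "\<And>A. F A = eval_mpoly (\<lambda>c. c) (\<lambda>(i, j). A $ i $ j) P"
    using F unfolding matrix_poly_def by blast
  let ?U = "{A. invertible A \<and> F A \<noteq> 0}"
  have "zariski_open_GL ?U"
    unfolding zariski_open_GL_def by (rule exI[of _ "{P}"]) (simp add: P)
  moreover have "?U \<noteq> {}" using A by blast
  ultimately show ?thesis unfolding has_gin_def using eq by blast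
qed

section \<open>Spaces with a member on every line\<close>

text \<open>The coefficients of a linear form vanishing at \<open>x\<close> and \<open>y\<close>;
  over a field they are all zero exactly when \<open>x\<close> and \<open>y\<close> are
  dependent.\<close>

definition cross_prod :: "'k::comm_ring_1 ^ 3 \<Rightarrow> 'k ^ 3 \<Rightarrow> 'k ^ 3"
  where "cross_prod x y = vector [x $ 2 * y $ 3 - x $ 3 * y $ 2, x $ 3 * y $ 1 - x $ 1 * y $ 3,
    x $ 1 * y $ 2 - x $ 2 * y $ 1]"

definition linear_form :: "'k::comm_ring_1 ^ 3 \<Rightarrow> ('k, 3) mpoly"
  where "linear_form c = (\<Sum>i\<in>UNIV. Const (c $ i) * Var i)"

lemma homogeneous_linear_form: "homogeneous 1 (linear_form c)"
  unfolding linear_form_def by (rule homogeneous_linear_sum)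

lemma ev_linear_form: "ev v (linear_form c) = v $ 1 * c $ 1 + v $ 2 * c $ 2 + v $ 3 * c $ 3"
  by (simp add: linear_form_def ev_simps sum_3 mult.commute)

text \<open>Pairing a vector with the cross product gives a determinant, which is zero if a row is
  repeated.\<close>

lemma ev_linear_form_cross_prod:
  "ev x (linear_form (cross_prod x y)) = 0" "ev y (linear_form (cross_prod x y)) = 0"
  "ev (A $ 3) (linear_form (cross_prod (A $ 1) (A $ 2))) = det A"
  by (simp_all add: ev_linear_form cross_prod_def det_3 algebra_simps)

text \<open>
  That \<open>x\<^sub>1\<^sup>2x\<^sub>3\<close> and not \<open>x\<^sub>2\<^sup>3\<close> lies in \<open>gin(V)\<close> reflects that every linear form divides a
  nonzero member of \<open>V\<close>.
\<close>

lemma has_gin_if_member_on_every_line: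
  fixes T :: "('k::field_char_0, 3) mpoly set" and f :: "3 \<Rightarrow> ('k, 3) mpoly"
  assumes T: "finite T" "card T \<le> 4" "\<And>t. t \<in> T \<Longrightarrow> homogeneous 3 t"
    and f: "\<And>i. f i \<in> mpoly.span T"
    and Q: "\<And>c. homogeneous 2 (Q c)" "\<And>c. linear_form c * Q c \<in> mpoly.span T"
      "matrix_poly (\<lambda>A. ev (A $ 1) (Q (cross_prod (A $ 1) (A $ 2))))"
    and A: "det A \<noteq> 0" "det (\<chi> i. line_coeffs (f i) (A $ 1) (A $ 2)) \<noteq> 0"
      "ev (A $ 1) (Q (cross_prod (A $ 1) (A $ 2))) \<noteq> 0"
  shows "has_gin (mpoly.span T) (mpoly.span gin_cubics)"
proof (rule has_ginI)
  let ?F = "\<lambda>A :: 'k ^ 3 ^ 3. det (\<chi> i. line_coeffs (f i) (A $ 1) (A $ 2))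
    * ev (A $ 1) (Q (cross_prod (A $ 1) (A $ 2)))"
  show "matrix_poly ?F"
    by (intro matrix_poly_mult Q(3) matrix_poly_det) (simp add: matrix_poly_line_coeffs)
  show "invertible A" "?F A \<noteq> 0" using A by (simp_all add: invertible_det_nz)
  fix B :: "'k ^ 3 ^ 3" assume B: "invertible B" "?F B \<noteq> 0"
  then have "det B \<noteq> 0" "det (\<chi> i. line_coeffs (f i) (B $ 1) (B $ 2)) \<noteq> 0"
    "ev (B $ 1) (Q (cross_prod (B $ 1) (B $ 2))) \<noteq> 0"
    by (simp_all add: invertible_det_nz)
  then show "initial_space (lin_act B ` mpoly.span T) = mpoly.span gin_cubics"
    by (intro initial_space_lin_act_eq_gin[OF T, where f = f and l = "linear_form (cross_prod (B $ 1) (B $ 2))"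
          and q = "Q (cross_prod (B $ 1) (B $ 2))"])
      (use f Q in \<open>simp_all add: ev_linear_form_cross_prod homogeneous_linear_form del: One_nat_def\<close>)
qed

text \<open>The degrees are numerals so that the rules apply backwards to forms as written; the
  general rules produce sums of degrees.\<close>

lemma homogeneous_intros:
  fixes f g :: "('k::comm_ring_1, 'v::finite) mpoly"
  shows "homogeneous 1 (Var i :: ('k, 'v) mpoly)"
    and "homogeneous 1 (Const c * Var i :: ('k, 'v) mpoly)"
    and "homogeneous 2 f \<Longrightarrow> homogeneous 2 (Const c * f)"
    and "homogeneous 1 f \<Longrightarrow> homogeneous 1 g \<Longrightarrow> homogeneous 2 (f * g)"
    and "homogeneous 1 f \<Longrightarrow> homogeneous 2 g \<Longrightarrow> homogeneous 3 (f * g)"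
    and "homogeneous 2 f \<Longrightarrow> homogeneous 1 g \<Longrightarrow> homogeneous 3 (f * g)"
    and "homogeneous 1 f \<Longrightarrow> homogeneous 2 (f ^ 2)"
    and "homogeneous 1 f \<Longrightarrow> homogeneous 3 (f ^ 3)"
  using homogeneous_mult[of 1 f 1 g] homogeneous_mult[of 1 f 2 g] homogeneous_mult[of 2 f 1 g]
    homogeneous_power[of 1 f 2] homogeneous_power[of 1 f 3] homogeneous_Var[of i]
    homogeneous_mult[OF homogeneous_Const homogeneous_Var, of c i]
    homogeneous_mult[OF homogeneous_Const, of 2 f c]
  by (simp_all add: numeral_2_eq_2 numeral_3_eq_3)

text \<open>Because \<open>?Q c\<close> is squarefree, its product with the linear form has no
  cubes, and the coefficients of x1 x2^2 and x1 x3^2 agree, both being \<open>c $ 2 * c $ 3\<close>;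
  likewise for the other variables.\<close>

lemma has_gin_three_points:
  fixes T :: "('k::field_char_0, 3) mpoly set"
  defines "T \<equiv> {Var 1 * (Var 2 ^ 2 + Var 3 ^ 2), Var 2 * (Var 1 ^ 2 + Var 3 ^ 2),
    Var 3 * (Var 1 ^ 2 + Var 2 ^ 2), Var 1 * Var 2 * Var 3}"
  shows "has_gin (mpoly.span T) (mpoly.span gin_cubics)"
proof (rule has_gin_if_member_on_every_line)
  let ?f = "vector [Var 1 * (Var 2 ^ 2 + Var 3 ^ 2), Var 3 * (Var 1 ^ 2 + Var 2 ^ 2),
    Var 1 * Var 2 * Var 3] :: ('k, 3) mpoly ^ 3"
  let ?Q = "\<lambda>c :: 'k ^ 3. Const (c $ 1) * (Var 2 * Var 3) + Const (c $ 2) * (Var 1 * Var 3)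
    + Const (c $ 3) * (Var 1 * Var 2) :: ('k, 3) mpoly"
  \<comment> \<open>A sample line with points (t, s, 2s + t): the coefficient rows are (0,5,4),
    (2,1,2), (0,2,1), so the minor is 6, and the cofactor has value 2 at the first row.\<close>
  let ?A = "vector [vector [0, 1, 2], vector [1, 0, 1], vector [1, 0, 0]] :: 'k ^ 3 ^ 3"
  show "finite T" "card T \<le> 4" by (simp_all add: T_def card_insert_if)
  show "homogeneous 3 t" if "t \<in> T" for t
    using that unfolding T_def
    by (elim insertE emptyE; hypsubst) (blast intro: homogeneous_intros homogeneous_add)+
  have "?f $ i \<in> T" for i using exhaust_3[of i] by (auto simp: T_def)
  then show "?f $ i \<in> mpoly.span T" for i by (rule mpoly.span_base)
  show "homogeneous 2 (?Q c)" for c by (intro homogeneous_intros homogeneous_add)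
  show "linear_form c * ?Q c \<in> mpoly.span T" for c
  proof -
    have "linear_form c * ?Q c = smult_mpoly (c $ 2 * c $ 3) (Var 1 * (Var 2 ^ 2 + Var 3 ^ 2))
      + smult_mpoly (c $ 1 * c $ 3) (Var 2 * (Var 1 ^ 2 + Var 3 ^ 2))
      + smult_mpoly (c $ 1 * c $ 2) (Var 3 * (Var 1 ^ 2 + Var 2 ^ 2))
      + smult_mpoly (c $ 1 ^ 2 + c $ 2 ^ 2 + c $ 3 ^ 2) (Var 1 * Var 2 * Var 3)"
      by (rule mpoly3_eqI) (simp add: ev_simps linear_form_def sum_3 power2_eq_square algebra_simps)
    also have "\<dots> \<in> mpoly.span T"
      by (intro mpoly.span_add mpoly.span_scale mpoly.span_base) (simp_all add: T_def)
    finally show ?thesis .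
  qed
  show "matrix_poly (\<lambda>A. ev (A $ 1) (?Q (cross_prod (A $ 1) (A $ 2))))"
    unfolding ev_simps cross_prod_def vector_3
    by (intro matrix_poly_add matrix_poly_diff matrix_poly_mult matrix_poly_entry)
  show "det ?A \<noteq> 0" "ev (?A $ 1) (?Q (cross_prod (?A $ 1) (?A $ 2))) \<noteq> 0"
    by (simp_all add: det_3 cross_prod_def ev_simps)
  show "det (\<chi> i. line_coeffs (?f $ i) (?A $ 1) (?A $ 2)) \<noteq> 0"
    by (simp add: det_3 line_coeffs_def ev_simps power2_eq_square)
qed

text \<open>The span consists of the cubics invariant under cyclic permutation of the variables. The
  cofactor \<open>?Q c\<close> is the product of the two other cyclic translates of the linear form,
  so the full product is invariant.\<close>

lemma has_gin_cyclic:
  fixes T :: "('k::field_char_0, 3) mpoly set"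
  defines "T \<equiv> {Var 1 ^ 3 + Var 2 ^ 3 + Var 3 ^ 3,
    Var 1 ^ 2 * Var 2 + Var 2 ^ 2 * Var 3 + Var 3 ^ 2 * Var 1,
    Var 1 * Var 2 ^ 2 + Var 2 * Var 3 ^ 2 + Var 3 * Var 1 ^ 2,
    Var 1 * Var 2 * Var 3}"
  shows "has_gin (mpoly.span T) (mpoly.span gin_cubics)"
proof (rule has_gin_if_member_on_every_line)
  let ?f = "vector [Var 1 ^ 3 + Var 2 ^ 3 + Var 3 ^ 3,
    Var 1 ^ 2 * Var 2 + Var 2 ^ 2 * Var 3 + Var 3 ^ 2 * Var 1,
    Var 1 * Var 2 * Var 3] :: ('k, 3) mpoly ^ 3"
  let ?Q = "\<lambda>c :: 'k ^ 3. Const (c $ 2 * c $ 3) * Var 1 ^ 2 + Const (c $ 1 * c $ 3) * Var 2 ^ 2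
    + Const (c $ 1 * c $ 2) * Var 3 ^ 2
    + Const (c $ 1 * c $ 1 + c $ 2 * c $ 3) * (Var 2 * Var 3)
    + Const (c $ 2 * c $ 2 + c $ 1 * c $ 3) * (Var 1 * Var 3)
    + Const (c $ 3 * c $ 3 + c $ 1 * c $ 2) * (Var 1 * Var 2) :: ('k, 3) mpoly"
  \<comment> \<open>A sample line with points (s, t, t): the coefficient rows are (1,0,0), (0,1,1),
    (0,0,1), and the cofactor has value -1 at the first row.\<close>
  let ?A = "vector [vector [1, 0, 0], vector [0, 1, 1], vector [0, 0, 1]] :: 'k ^ 3 ^ 3"
  show "finite T" "card T \<le> 4" by (simp_all add: T_def card_insert_if)
  show "homogeneous 3 t" if "t \<in> T" for t
    using that unfolding T_def
    by (elim insertE emptyE; hypsubst) (blast intro: homogeneous_intros homogeneous_add)+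
  have "?f $ i \<in> T" for i using exhaust_3[of i] by (auto simp: T_def)
  then show "?f $ i \<in> mpoly.span T" for i by (rule mpoly.span_base)
  show "homogeneous 2 (?Q c)" for c by (intro homogeneous_intros homogeneous_add)
  show "linear_form c * ?Q c \<in> mpoly.span T" for c
  proof -
    let ?a = "c $ 1" and ?b = "c $ 2" and ?c = "c $ 3"
    have "linear_form c * ?Q c = smult_mpoly (?a * ?b * ?c) (Var 1 ^ 3 + Var 2 ^ 3 + Var 3 ^ 3)
      + smult_mpoly (?a * ?c ^ 2 + ?a ^ 2 * ?b + ?b ^ 2 * ?c)
        (Var 1 ^ 2 * Var 2 + Var 2 ^ 2 * Var 3 + Var 3 ^ 2 * Var 1)
      + smult_mpoly (?b * ?c ^ 2 + ?a * ?b ^ 2 + ?c * ?a ^ 2)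
        (Var 1 * Var 2 ^ 2 + Var 2 * Var 3 ^ 2 + Var 3 * Var 1 ^ 2)
      + smult_mpoly (?a ^ 3 + ?b ^ 3 + ?c ^ 3 + 3 * ?a * ?b * ?c) (Var 1 * Var 2 * Var 3)"
      by (rule mpoly3_eqI)
        (simp add: ev_simps linear_form_def sum_3 power2_eq_square power3_eq_cube algebra_simps)
    also have "\<dots> \<in> mpoly.span T"
      by (intro mpoly.span_add mpoly.span_scale mpoly.span_base) (simp_all add: T_def)
    finally show ?thesis .
  qed
  show "matrix_poly (\<lambda>A. ev (A $ 1) (?Q (cross_prod (A $ 1) (A $ 2))))"
    unfolding ev_simps cross_prod_def vector_3
    by (intro matrix_poly_add matrix_poly_diff matrix_poly_mult matrix_poly_power matrix_poly_entry)
  show "det ?A \<noteq> 0" "ev (?A $ 1) (?Q (cross_prod (?A $ 1) (?A $ 2))) \<noteq> 0"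
    by (simp_all add: det_3 cross_prod_def ev_simps)
  show "det (\<chi> i. line_coeffs (?f $ i) (?A $ 1) (?A $ 2)) \<noteq> 0"
    by (simp add: det_3 line_coeffs_def ev_simps power2_eq_square)
qed

section \<open>Univariate polynomial functions\<close>

definition univ_poly :: "('a::comm_ring_1 \<Rightarrow> 'a) \<Rightarrow> bool"
  where "univ_poly F \<longleftrightarrow> (\<exists>r. \<forall>t. poly r t = F t)"

lemma univ_poly_intros:
  fixes F G :: "'a::comm_ring_1 \<Rightarrow> 'a"
  shows "univ_poly (\<lambda>t :: 'a. c)" "univ_poly (\<lambda>t :: 'a. t)"
  "univ_poly F \<Longrightarrow> univ_poly G \<Longrightarrow> univ_poly (\<lambda>t. F t + G t)"
  "univ_poly F \<Longrightarrow> univ_poly G \<Longrightarrow> univ_poly (\<lambda>t. F t - G t)"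
  "univ_poly F \<Longrightarrow> univ_poly G \<Longrightarrow> univ_poly (\<lambda>t. F t * G t)"
  "univ_poly F \<Longrightarrow> univ_poly (\<lambda>t. F t ^ n)"
proof -
  show "univ_poly (\<lambda>t :: 'a. c)" unfolding univ_poly_def by (rule exI[of _ "[:c:]"]) simp
  show "univ_poly (\<lambda>t :: 'a. t)" unfolding univ_poly_def by (rule exI[of _ "[:0, 1:]"]) simp
  show "univ_poly F \<Longrightarrow> univ_poly G \<Longrightarrow> univ_poly (\<lambda>t. F t + G t)"
    unfolding univ_poly_def by (metis poly_add)
  show "univ_poly F \<Longrightarrow> univ_poly G \<Longrightarrow> univ_poly (\<lambda>t. F t - G t)"
    unfolding univ_poly_def by (metis poly_diff)
  show "univ_poly F \<Longrightarrow> univ_poly G \<Longrightarrow> univ_poly (\<lambda>t. F t * G t)"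
    unfolding univ_poly_def by (metis poly_mult)
  show "univ_poly F \<Longrightarrow> univ_poly (\<lambda>t. F t ^ n)"
    unfolding univ_poly_def by (metis poly_power)
qed

text \<open>Extends identities to t = 0 when their derivation divides by t.\<close>

lemma univ_poly_eq_0_at_0:
  fixes F :: "'a::field_char_0 \<Rightarrow> 'a"
  assumes "univ_poly F" "\<And>t. t \<noteq> 0 \<Longrightarrow> F t = 0"
  shows "F 0 = 0"
proof -
  obtain r where r: "\<And>t. poly r t = F t" using assms(1) unfolding univ_poly_def by blast
  have "UNIV \<subseteq> insert 0 {t. poly r t = 0}" using assms(2) by (auto simp: r)
  then have "infinite {t. poly r t = 0}"
    using infinite_UNIV_char_0[where 'a = 'a] by (meson finite_insert finite_subset)
  then have "r = 0" using poly_roots_finite[of r] by (cases "r = 0") simp_all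
  then show ?thesis using r[of 0] by simp
qed

section \<open>A quadric and a cubic\<close>

lemma (in coeff_hom) eval_homogeneous_scale:
  fixes f :: "('k, 'v::finite) mpoly"
  assumes "homogeneous d f"
  shows "eval_mpoly h (\<lambda>i. c * a i) f = c ^ d * eval_mpoly h a f"
proof -
  have "(\<Prod>i\<in>UNIV. (c * a i) ^ (m $ i)) = c ^ d * (\<Prod>i\<in>UNIV. a i ^ (m $ i))"
    if "m \<in> Poly_Mapping.keys f" for m
  proof -
    have "mdeg m = d" using assms that by (simp add: homogeneous_def)
    then show ?thesis by (simp add: power_mult_distrib prod.distrib mdeg_def flip: power_sum)
  qed
  then show ?thesis
    unfolding eval_mpoly_def sum_distrib_left
    by (intro sum.cong[OF refl]) (simp add: mult.left_commute)
qed

lemma ev_homogeneous_scale: "homogeneous d f \<Longrightarrow> ev (c *s v) f = c ^ d * ev v f"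
  using id.eval_homogeneous_scale[of d f c "\<lambda>i. v $ i"] by (simp add: ev_def)

text \<open>For a quadratic form \<open>q\<close>, the coefficient of st in q(s a + t v).\<close>

definition quadric_mid :: "('k::field, 3) mpoly \<Rightarrow> 'k ^ 3 \<Rightarrow> 'k ^ 3 \<Rightarrow> 'k"
  where "quadric_mid q a v = (ev (a + v) q - ev (a - v) q) / 2"

text \<open>
  Up to the factor \<open>q\<^sup>3/2\<close> this is the second derivative of \<open>p/q\<close> at \<open>a\<close> in direction \<open>v\<close>,
  written in the coefficients of \<open>p\<close> and \<open>q\<close> on the line through \<open>a\<close> and \<open>v\<close>.
\<close>

definition ratio_hessian :: "('k::field, 3) mpoly \<Rightarrow> ('k, 3) mpoly \<Rightarrow> 'k ^ 3 \<Rightarrow> 'k ^ 3 \<Rightarrow> 'k"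
  where "ratio_hessian p q a v =
    (let P = line_coeffs p a v; q0 = ev a q; q1 = quadric_mid q a v; q2 = ev v q
     in q0 ^ 2 * P $ 3 - q0 * q1 * P $ 2 + q1 ^ 2 * P $ 1 - q0 * q2 * P $ 1)"

lemma ev_line_quadric:
  fixes q :: "('k::field_char_0, 3) mpoly"
  assumes "homogeneous 2 q"
  shows "ev (s *s a + t *s v) q = ev a q * s ^ 2 + quadric_mid q a v * s * t + ev v q * t ^ 2"
proof -
  let ?A = "vector [a, v, 0] :: 'k ^ 3 ^ 3"
  have e: "ev (s *s a + t *s v) q = ev (vector [s, t, 0]) (lin_act ?A q)" for s t
    by (simp only: ev_vector3_lin_act vector_3) simp
  note c = ev_quadratic[OF homogeneous_lin_act[OF assms], of _ ?A]
  \<comment> \<open>Only the shape of the binary form is needed here; four values then identify its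
    coefficients.\<close>
  obtain c0 c1 c2 where c: "\<And>s t. ev (s *s a + t *s v) q = c0 * s ^ 2 + c1 * s * t + c2 * t ^ 2"
    by (rule that) (simp add: e c mult.assoc)
  have "ev a q = c0" "ev v q = c2" "ev (a + v) q = c0 + c1 + c2" "ev (a - v) q = c0 - c1 + c2"
    using c[of 1 0] c[of 0 1] c[of 1 1] c[of 1 "-1"] by simp_all
  then show ?thesis by (simp add: c quadric_mid_def)
qed

lemma ev_line_cubic:
  fixes p :: "('k::field_char_0, 3) mpoly"
  assumes "homogeneous 3 p"
  shows "ev (s *s a + t *s v) p = line_coeffs p a v $ 1 * s ^ 3 + line_coeffs p a v $ 2 * s ^ 2 * t
    + line_coeffs p a v $ 3 * s * t ^ 2 + ev v p * t ^ 3"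
proof -
  let ?A = "vector [a, v, 0] :: 'k ^ 3 ^ 3"
  have e: "ev (s *s a + t *s v) p = ev (vector [s, t, 0]) (lin_act ?A p)" for s t
    by (simp only: ev_vector3_lin_act vector_3) simp
  note c = ev_cubic[OF homogeneous_lin_act[OF assms], of _ ?A]
  obtain c0 c1 c2 c3
    where c: "\<And>s t. ev (s *s a + t *s v) p = c0 * s ^ 3 + c1 * s ^ 2 * t + c2 * s * t ^ 2 + c3 * t ^ 3"
    by (rule that) (simp add: e c mult.assoc)
  have v: "ev a p = c0" "ev v p = c3" "ev (a + v) p = c0 + c1 + c2 + c3"
    "ev (a - v) p = c0 - c1 + c2 - c3"
    using c[of 1 0] c[of 0 1] c[of 1 1] c[of 1 "-1"] by simp_all
  have "(c0 + c1 + c2 + c3 - (c0 - c1 + c2 - c3)) / 2 - c3 = c1"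
    "(c0 + c1 + c2 + c3 + (c0 - c1 + c2 - c3)) / 2 - c0 = c2"
    by (simp_all add: field_simps)
  then show ?thesis by (simp only: c line_coeffs_def vector_3 v)
qed

text \<open>This is the derivative of \<open>q\<close> along the line at parameter t.\<close>

lemma quadric_mid_shift:
  fixes q :: "('k::field_char_0, 3) mpoly"
  assumes "homogeneous 2 q"
  shows "quadric_mid q (a + t *s v) v = quadric_mid q a v + 2 * ev v q * t"
proof -
  have e: "a + t *s v + v = 1 *s a + (t + 1) *s v" "a + t *s v - v = 1 *s a + (t - 1) *s v"
    by (simp_all add: vec_eq_iff algebra_simps)
  show ?thesis
    unfolding quadric_mid_def[of q "a + t *s v"] e ev_line_quadric[OF assms]
    by (simp add: field_simps power2_eq_square)
qed

text \<open>The Taylor coefficients of orders 0, 1, 2 of \<open>p\<close> along the line at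
  parameter t.\<close>

lemma line_coeffs_shift:
  fixes p :: "('k::field_char_0, 3) mpoly" and a v :: "'k ^ 3"
  assumes "homogeneous 3 p"
  defines "P \<equiv> line_coeffs p a v"
  shows "line_coeffs p (a + t *s v) v $ 1 = P $ 1 + P $ 2 * t + P $ 3 * t ^ 2 + ev v p * t ^ 3"
    and "line_coeffs p (a + t *s v) v $ 2 = P $ 2 + 2 * P $ 3 * t + 3 * ev v p * t ^ 2"
    and "line_coeffs p (a + t *s v) v $ 3 = P $ 3 + 3 * ev v p * t"
proof -
  have e: "a + t *s v + v = 1 *s a + (t + 1) *s v" "a + t *s v - v = 1 *s a + (t - 1) *s v"
    "a + t *s v = 1 *s a + t *s v"
    by (simp_all add: vec_eq_iff algebra_simps)
  show "line_coeffs p (a + t *s v) v $ 1 = P $ 1 + P $ 2 * t + P $ 3 * t ^ 2 + ev v p * t ^ 3"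
    and "line_coeffs p (a + t *s v) v $ 2 = P $ 2 + 2 * P $ 3 * t + 3 * ev v p * t ^ 2"
    and "line_coeffs p (a + t *s v) v $ 3 = P $ 3 + 3 * ev v p * t"
    unfolding line_coeffs_def[of p "a + t *s v"] vector_3
    unfolding e(1,2) unfolding e(3) ev_line_cubic[OF assms(1)] P_def[symmetric]
    by (simp_all add: field_simps power2_eq_square power3_eq_cube)
qed

text \<open>
  Otherwise \<open>p = (l\<^sub>0 + l\<^sub>1 t) q + b t\<^sup>3\<close> with \<open>b \<noteq> 0\<close>, and the numerator
  of the second derivative has linear term \<open>3 b q\<^sub>0\<^sup>2 t\<close>.
\<close>

lemma cubic_over_quadratic_affine:
  fixes q0 q1 q2 p0 p1 p2 p3 :: "'k::field_char_0"
  defines "Q0 \<equiv> \<lambda>t. q0 + q1 * t + q2 * t ^ 2" and "Q1 \<equiv> \<lambda>t. q1 + 2 * q2 * t"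
  assumes q0: "q0 \<noteq> 0"
    and D: "\<And>t. Q0 t * (Q0 t ^ 2 * (p2 + 3 * p3 * t) - Q0 t * Q1 t * (p1 + 2 * p2 * t + 3 * p3 * t ^ 2)
      + Q1 t ^ 2 * (p0 + p1 * t + p2 * t ^ 2 + p3 * t ^ 3)
      - Q0 t * q2 * (p0 + p1 * t + p2 * t ^ 2 + p3 * t ^ 3)) = 0"
  shows "q0 ^ 2 * (p0 + p1 + p2 + p3) = (q0 * p0 + q0 * p1 - p0 * q1) * (q0 + q1 + q2)"
proof -
  \<comment> \<open>\<open>l0 + l1 * t\<close> is the first-order expansion of p/q at t = 0, and
    \<open>b\<close> is the defect in the t^3 coefficient. The hypothesis at t = 0 then fixes
    \<open>p2\<close>.\<close>
  define l0 l1 b where "l0 = p0 / q0" and "l1 = (p1 - l0 * q1) / q0" and "b = p3 - l1 * q2"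
  have p0: "p0 = l0 * q0" and p1: "p1 = l0 * q1 + l1 * q0" and p3: "p3 = l1 * q2 + b"
    using q0 by (simp_all add: l0_def l1_def b_def)
  have "q0 * (q0 ^ 2 * p2 - q0 * q1 * p1 + q1 ^ 2 * p0 - q0 * q2 * p0) = 0"
    using D[of 0] by (simp add: Q0_def Q1_def)
  then have "q0 ^ 2 * p2 - q0 * q1 * p1 + q1 ^ 2 * p0 - q0 * q2 * p0 = 0" using q0 by simp
  also have "q0 ^ 2 * p2 - q0 * q1 * p1 + q1 ^ 2 * p0 - q0 * q2 * p0 = q0 ^ 2 * (p2 - (l0 * q2 + l1 * q1))"
    by (simp add: p0 p1 algebra_simps power2_eq_square)
  finally have "q0 ^ 2 * (p2 - (l0 * q2 + l1 * q1)) = 0" .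
  then have p2: "p2 = l0 * q2 + l1 * q1" using q0 by simp
  \<comment> \<open>The hypothesis \<open>D\<close> divided by \<open>b * t\<close>; its value at 0
    is 3 q0^3.\<close>
  let ?F = "\<lambda>t. Q0 t * (3 * Q0 t ^ 2 - 3 * t * Q0 t * Q1 t + t ^ 2 * (Q1 t ^ 2 - Q0 t * q2))"
  have "b = 0"
  proof (rule ccontr)
    assume "b \<noteq> 0"
    have "?F t = 0" if "t \<noteq> 0" for t
    proof -
      have "b * t * ?F t = Q0 t * (Q0 t ^ 2 * (p2 + 3 * p3 * t)
        - Q0 t * Q1 t * (p1 + 2 * p2 * t + 3 * p3 * t ^ 2)
        + Q1 t ^ 2 * (p0 + p1 * t + p2 * t ^ 2 + p3 * t ^ 3)
        - Q0 t * q2 * (p0 + p1 * t + p2 * t ^ 2 + p3 * t ^ 3))"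
        unfolding p0 p1 p2 p3 Q0_def Q1_def
        by (simp add: algebra_simps power2_eq_square power3_eq_cube)
      also have "\<dots> = 0" by (rule D)
      finally show ?thesis using that \<open>b \<noteq> 0\<close> by simp
    qed
    moreover have "univ_poly ?F" unfolding Q0_def Q1_def by (intro univ_poly_intros)
    ultimately have "?F 0 = 0" by (rule univ_poly_eq_0_at_0[rotated])
    then show False using q0 by (simp add: Q0_def)
  qed
  then show ?thesis unfolding p0 p1 p2 p3 by (simp add: algebra_simps power2_eq_square)
qed

lemma ev_eval_mpoly_Const: "ev v (eval_mpoly Const b f) = ev (\<chi> j. ev v (b j)) f"
  by (simp add: hom_eval_mpoly[OF coeff_hom_ev] ev_simps) (simp add: ev_def)

text \<open>Along every line through \<open>a\<close> the quotient p/q is affine, so it equals its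
  first-order Taylor polynomial \<open>L\<close> at \<open>a\<close>. The product in
  \<open>H\<close> is the function whose nonvanishing will define the open set.\<close>

lemma quadric_dvd_cubic:
  fixes p q :: "('k::field_char_0, 3) mpoly"
  assumes q: "homogeneous 2 q" "ev a q \<noteq> 0" and p: "homogeneous 3 p"
    and H: "\<And>x v. ev x q * ratio_hessian p q x v = 0"
  shows "q dvd p"
proof -
  define q0 p0 where "q0 = ev a q" and "p0 = ev a p"
  have main: "q0 ^ 2 * ev (a + v) p
    = (q0 * p0 + q0 * line_coeffs p a v $ 2 - p0 * quadric_mid q a v) * ev (a + v) q" for v
  proof -
    let ?P = "line_coeffs p a v"
    have P1: "?P $ 1 = p0" by (simp add: line_coeffs_def p0_def)
    have Q: "ev (a + t *s v) q = q0 + quadric_mid q a v * t + ev v q * t ^ 2" for t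
      using ev_line_quadric[OF q(1), of 1 a t v] by (simp add: q0_def)
    have P: "ev (a + t *s v) p = p0 + ?P $ 2 * t + ?P $ 3 * t ^ 2 + ev v p * t ^ 3" for t
      using ev_line_cubic[OF p, of 1 a t v] by (simp add: P1)
    have "q0 ^ 2 * (p0 + ?P $ 2 + ?P $ 3 + ev v p)
      = (q0 * p0 + q0 * ?P $ 2 - p0 * quadric_mid q a v) * (q0 + quadric_mid q a v + ev v q)"
    proof (rule cubic_over_quadratic_affine)
      show "q0 \<noteq> 0" using q(2) by (simp add: q0_def)
      fix t
      show "(q0 + quadric_mid q a v * t + ev v q * t ^ 2) *
        ((q0 + quadric_mid q a v * t + ev v q * t ^ 2) ^ 2 * (?P $ 3 + 3 * ev v p * t)
        - (q0 + quadric_mid q a v * t + ev v q * t ^ 2) * (quadric_mid q a v + 2 * ev v q * t)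
          * (?P $ 2 + 2 * ?P $ 3 * t + 3 * ev v p * t ^ 2)
        + (quadric_mid q a v + 2 * ev v q * t) ^ 2
          * (p0 + ?P $ 2 * t + ?P $ 3 * t ^ 2 + ev v p * t ^ 3)
        - (q0 + quadric_mid q a v * t + ev v q * t ^ 2) * ev v q
          * (p0 + ?P $ 2 * t + ?P $ 3 * t ^ 2 + ev v p * t ^ 3)) = 0"
        using H[of "a + t *s v" v]
        unfolding ratio_hessian_def Let_def line_coeffs_shift[OF p] quadric_mid_shift[OF q(1)] Q P1 .
    qed
    then show ?thesis using P[of 1] Q[of 1] by simp
  qed
  \<comment> \<open>\<open>S f b c\<close> is f(b + c x), so values at translated and reflected
    points become polynomials in x.\<close>
  define S :: "('k, 3) mpoly \<Rightarrow> 'k ^ 3 \<Rightarrow> 'k \<Rightarrow> ('k, 3) mpoly"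
    where "S f b c = eval_mpoly Const (\<lambda>j. Const (b $ j) + Const c * Var j) f" for f b c
  have S: "ev x (S f b c) = ev (b + c *s x) f" for x f b c
    unfolding S_def ev_eval_mpoly_Const
    by (rule arg_cong[where f = "\<lambda>v. ev v f"]) (simp add: vec_eq_iff ev_simps)
  \<comment> \<open>The quotient rule at \<open>a\<close> in direction x - a, with both derivatives
    written by interpolation; the reflected point a - (x - a) is 2a - x.\<close>
  define L where "L = Const (inverse (q0 ^ 2)) * (Const (q0 * p0)
    + Const q0 * (Const (1 / 2) * (p - S p (2 *s a) (- 1)) - S p (- a) 1)
    - Const p0 * (Const (1 / 2) * (q - S q (2 *s a) (- 1))))"
  have "p = L * q"
  proof (rule mpoly3_eqI)
    fix x :: "'k ^ 3"
    have e: "a + (x - a) = x" "a - (x - a) = 2 *s a + - 1 *s x" "x - a = - a + 1 *s x"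
      by (simp_all add: vec_eq_iff)
    have "q0 \<noteq> 0" using q(2) by (simp add: q0_def)
    have L: "q0 ^ 2 * ev x L = q0 * p0 + q0 * line_coeffs p a (x - a) $ 2 - p0 * quadric_mid q a (x - a)"
      unfolding L_def ev_simps S line_coeffs_def quadric_mid_def vector_3 e(1,2) unfolding e(3)
      using \<open>q0 \<noteq> 0\<close> by simp
    have "q0 ^ 2 * ev x p = q0 ^ 2 * ev x L * ev x q"
      using main[of "x - a"] unfolding L by (simp add: e(1))
    with \<open>q0 \<noteq> 0\<close> show "ev x p = ev x (L * q)" by (simp add: ev_simps)
  qed
  then show ?thesis by simp
qed

text \<open>The quotient p/q is homogeneous of degree 1, hence linear along the line through the
  origin and \<open>a\<close>. So a nonzero value forces independent directions, which extend to an
  invertible matrix.\<close>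

lemma ratio_hessian_parallel:
  fixes p q :: "('k::field_char_0, 3) mpoly"
  assumes "homogeneous 2 q" "homogeneous 3 p"
  shows "ratio_hessian p q a (c *s a) = 0"
proof -
  have e: "a + c *s a = (1 + c) *s a" "a - c *s a = (1 - c) *s a"
    by (simp_all add: vec_eq_iff algebra_simps)
  show ?thesis
    unfolding ratio_hessian_def Let_def line_coeffs_def quadric_mid_def vector_3 e
      ev_homogeneous_scale[OF assms(1)] ev_homogeneous_scale[OF assms(2)]
    by (simp add: field_simps power2_eq_square power3_eq_cube)
qed

lemma cross_prod_eq_0:
  fixes a v :: "'k::field ^ 3"
  assumes "cross_prod a v = 0" "a \<noteq> 0"
  obtains c where "v = c *s a"
proof -
  have c: "a $ 2 * v $ 3 = a $ 3 * v $ 2" "a $ 3 * v $ 1 = a $ 1 * v $ 3" "a $ 1 * v $ 2 = a $ 2 * v $ 1"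
    using assms(1) by (simp_all add: cross_prod_def vec_eq_iff forall_3)
  obtain i where i: "a $ i \<noteq> 0" using assms(2) by (auto simp: vec_eq_iff)
  have "v = (v $ i / a $ i) *s a"
    using exhaust_3[of i] i c by (auto simp: vec_eq_iff forall_3 field_simps)
  then show ?thesis by (rule that)
qed

text \<open>In the coordinates \<open>y j\<close> dual to the rows of the matrix,
  \<open>y 1 * q\<close>, \<open>y 2 * q\<close> and \<open>p\<close> supply the minor, and
  \<open>y 3 * q\<close> supplies the multiple of the equation of the line.\<close>

lemma has_gin_quadric_cubic:
  fixes p q :: "('k::field_char_0, 3) mpoly"
  assumes q: "homogeneous 2 q" "q \<noteq> 0" and p: "homogeneous 3 p" and ndvd: "\<not> q dvd p"
  shows "has_gin (mpoly.span {Var 1 * q, Var 2 * q, Var 3 * q, p}) (mpoly.span gin_cubics)"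
proof -
  let ?T = "{Var 1 * q, Var 2 * q, Var 3 * q, p}"
  let ?F = "\<lambda>A :: 'k ^ 3 ^ 3. ev (A $ 1) q * ratio_hessian p q (A $ 1) (A $ 2)"
  obtain b where "ev b q \<noteq> 0" using mpoly3_eq_0I[of q] q(2) by blast
  with quadric_dvd_cubic[OF q(1) _ p] ndvd
  obtain a v where av: "ev a q * ratio_hessian p q a v \<noteq> 0" by blast
  have "a \<noteq> 0"
  proof
    assume "a = 0"
    then have "ev a q = 0" using ev_homogeneous_scale[OF q(1), of 0 0] by simp
    with av show False by simp
  qed
  have "cross_prod a v \<noteq> 0"
  proof
    assume "cross_prod a v = 0"
    then obtain c where "v = c *s a" using \<open>a \<noteq> 0\<close> by (rule cross_prod_eq_0)
    with av ratio_hessian_parallel[OF q(1) p] show False by simp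
  qed
  then obtain i where i: "cross_prod a v $ i \<noteq> 0" by (auto simp: vec_eq_iff)
  \<comment> \<open>The third row picks a nonzero coordinate of the cross product, which is then the
    determinant.\<close>
  define A where "A = (vector [a, v, axis i 1] :: 'k ^ 3 ^ 3)"
  have A: "A $ 1 = a" "A $ 2 = v" "A $ 3 = axis i 1" by (simp_all add: A_def)
  have "det A = ev (axis i 1) (linear_form (cross_prod a v))"
    using ev_linear_form_cross_prod(3)[of A] by (simp add: A)
  also have "\<dots> = cross_prod a v $ i"
    using exhaust_3[of i] by (auto simp: ev_linear_form axis_def)
  finally have "det A \<noteq> 0" using i by simp
  show ?thesis
  proof (rule has_ginI)
    show "matrix_poly ?F"
    proof -
      have 1: "matrix_poly (\<lambda>A. ev (A $ 1 + A $ 2) q)" "matrix_poly (\<lambda>A. ev (A $ 1 - A $ 2) q)"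
        by (rule matrix_poly_ev, simp add: matrix_poly_add matrix_poly_diff matrix_poly_entry)+
      have 2: "matrix_poly (\<lambda>A. ev (A $ i) q)" for i
        by (intro matrix_poly_ev matrix_poly_entry)
      show ?thesis
        unfolding ratio_hessian_def Let_def quadric_mid_def
        by (intro matrix_poly_mult matrix_poly_add matrix_poly_diff matrix_poly_power
            matrix_poly_divide_const matrix_poly_line_coeffs 1 2)
    qed
    show "invertible A" using \<open>det A \<noteq> 0\<close> by (simp add: invertible_det_nz)
    show "?F A \<noteq> 0" using av by (simp add: A)
    fix B :: "'k ^ 3 ^ 3" assume B: "invertible B" "?F B \<noteq> 0"
    obtain N where N: "B ** N = mat 1" using B(1) unfolding invertible_def by blast
    \<comment> \<open>The columns of the inverse give the dual basis of the rows of
      \<open>B\<close>.\<close>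
    define y where "y j = linear_form (\<chi> i. N $ i $ j)" for j
    have y: "ev (B $ i) (y j) = (if i = j then 1 else 0)" for i j
    proof -
      have "ev (B $ i) (y j) = (B ** N) $ i $ j"
        by (simp add: y_def ev_linear_form matrix_matrix_mult_def sum_3)
      then show ?thesis by (simp add: N mat_def)
    qed
    have y1: "homogeneous 1 (y j)" for j unfolding y_def by (rule homogeneous_linear_form)
    have yq: "y j * q \<in> mpoly.span ?T" for j
    proof -
      have "y j * q = smult_mpoly (N $ 1 $ j) (Var 1 * q) + smult_mpoly (N $ 2 $ j) (Var 2 * q)
        + smult_mpoly (N $ 3 $ j) (Var 3 * q)"
        by (simp add: y_def linear_form_def sum_3 smult_mpoly_def algebra_simps)
      also have "\<dots> \<in> mpoly.span ?T"
        by (intro mpoly.span_add mpoly.span_scale mpoly.span_base) simp_all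
      finally show ?thesis .
    qed
    let ?f = "vector [y 1 * q, y 2 * q, p] :: ('k, 3) mpoly ^ 3"
    have y_add: "ev (u + w) (y j) = ev u (y j) + ev w (y j)"
      "ev (u - w) (y j) = ev u (y j) - ev w (y j)" for u w j
      by (simp_all add: y_def ev_linear_form algebra_simps)
    let ?a = "B $ 1" and ?v = "B $ 2"
    have quad: "ev (?a + ?v) q = ev ?a q + quadric_mid q ?a ?v + ev ?v q"
      "ev (?a - ?v) q = ev ?a q - quadric_mid q ?a ?v + ev ?v q"
      using ev_line_quadric[OF q(1), of 1 ?a 1 ?v] ev_line_quadric[OF q(1), of 1 ?a "-1" ?v]
      by simp_all
    have c1: "line_coeffs (y 1 * q) ?a ?v = vector [ev ?a q, quadric_mid q ?a ?v, ev ?v q]"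
      and c2: "line_coeffs (y 2 * q) ?a ?v = vector [0, ev ?a q, quadric_mid q ?a ?v]"
      unfolding line_coeffs_def ev_simps y_add y quad by (simp_all add: field_simps)
    \<comment> \<open>The rows are (q0, q1, q2), (0, q0, q1) and the line coefficients of
      \<open>p\<close>.\<close>
    have "det (\<chi> i. line_coeffs (?f $ i) ?a ?v) = ratio_hessian p q ?a ?v"
      by (simp add: det_3 c1 c2) (simp add: ratio_hessian_def Let_def power2_eq_square algebra_simps)
    then have "det (\<chi> i. line_coeffs (?f $ i) ?a ?v) \<noteq> 0" using B(2) by simp
    moreover have "?f $ i \<in> mpoly.span ?T" for i
      using exhaust_3[of i] yq mpoly.span_base[of p ?T] by auto
    ultimately show "initial_space (lin_act B ` mpoly.span ?T) = mpoly.span gin_cubics"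
      using B(2) y1 q(1) yq
      by (intro initial_space_lin_act_eq_gin[of ?T "\<lambda>i. ?f $ i" B "y 3" q])
        (auto simp: y card_insert_if p simp del: One_nat_def intro: homogeneous_intros)
  qed
qed

section \<open>Common zeros of a quadric and a cubic\<close>

abbreviation lk :: "('k::zero, 3) mpoly \<Rightarrow> nat \<Rightarrow> nat \<Rightarrow> nat \<Rightarrow> 'k"
  where "lk f i j k \<equiv> Poly_Mapping.lookup f (vector [i, j, k])"

text \<open>
  For \<open>q = k\<^sub>0 (x\<^sub>1\<^sup>2 + b x\<^sub>1 + c)\<close> with forms \<open>b\<close>, \<open>c\<close> in \<open>x\<^sub>2, x\<^sub>3\<close>, the remainder of \<open>p\<close> modulo \<open>q\<close> is
  \<open>rem_lin * x\<^sub>1 + rem_const\<close>, and \<open>rem_norm\<close> is the resultant of \<open>p\<close> and \<open>q/k\<^sub>0\<close>.  The parameter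
  \<open>h\<close> carries the coefficients to the ring in which \<open>x\<^sub>2\<close>, \<open>x\<^sub>3\<close> take the values \<open>y\<close>, \<open>z\<close>.
\<close>

definition quad_lin :: "('k::field \<Rightarrow> 'r::comm_ring_1) \<Rightarrow> ('k, 3) mpoly \<Rightarrow> 'r \<Rightarrow> 'r \<Rightarrow> 'r"
  where "quad_lin h q y z = h (lk q 1 1 0 / lk q 2 0 0) * y + h (lk q 1 0 1 / lk q 2 0 0) * z"

definition quad_const :: "('k::field \<Rightarrow> 'r::comm_ring_1) \<Rightarrow> ('k, 3) mpoly \<Rightarrow> 'r \<Rightarrow> 'r \<Rightarrow> 'r"
  where "quad_const h q y z = h (lk q 0 2 0 / lk q 2 0 0) * y ^ 2
    + h (lk q 0 1 1 / lk q 2 0 0) * (y * z) + h (lk q 0 0 2 / lk q 2 0 0) * z ^ 2"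

definition quot_const :: "('k::field \<Rightarrow> 'r::comm_ring_1) \<Rightarrow> ('k, 3) mpoly \<Rightarrow> ('k, 3) mpoly \<Rightarrow> 'r \<Rightarrow> 'r \<Rightarrow> 'r"
  where "quot_const h p q y z = h (lk p 2 1 0) * y + h (lk p 2 0 1) * z - h (lk p 3 0 0) * quad_lin h q y z"

definition rem_lin :: "('k::field \<Rightarrow> 'r::comm_ring_1) \<Rightarrow> ('k, 3) mpoly \<Rightarrow> ('k, 3) mpoly \<Rightarrow> 'r \<Rightarrow> 'r \<Rightarrow> 'r"
  where "rem_lin h p q y z = h (lk p 1 2 0) * y ^ 2 + h (lk p 1 1 1) * (y * z) + h (lk p 1 0 2) * z ^ 2
    - h (lk p 3 0 0) * quad_const h q y z - quot_const h p q y z * quad_lin h q y z"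

definition rem_const :: "('k::field \<Rightarrow> 'r::comm_ring_1) \<Rightarrow> ('k, 3) mpoly \<Rightarrow> ('k, 3) mpoly \<Rightarrow> 'r \<Rightarrow> 'r \<Rightarrow> 'r"
  where "rem_const h p q y z = h (lk p 0 3 0) * y ^ 3 + h (lk p 0 2 1) * (y ^ 2 * z)
    + h (lk p 0 1 2) * (y * z ^ 2) + h (lk p 0 0 3) * z ^ 3 - quot_const h p q y z * quad_const h q y z"

definition rem_norm :: "('k::field \<Rightarrow> 'r::comm_ring_1) \<Rightarrow> ('k, 3) mpoly \<Rightarrow> ('k, 3) mpoly \<Rightarrow> 'r \<Rightarrow> 'r \<Rightarrow> 'r"
  where "rem_norm h p q y z = rem_const h p q y z ^ 2
    - quad_lin h q y z * rem_lin h p q y z * rem_const h p q y z + quad_const h q y z * rem_lin h p q y z ^ 2"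

lemmas rem_defs = quad_lin_def quad_const_def quot_const_def rem_lin_def rem_const_def rem_norm_def

lemma eval_quadric_monic:
  fixes h :: "'k::field \<Rightarrow> 'r::comm_ring_1"
  assumes h: "coeff_hom h" and q: "homogeneous 2 q" "lk q 2 0 0 \<noteq> 0"
  shows "eval_mpoly h a q = h (lk q 2 0 0) *
    (a 1 ^ 2 + quad_lin h q (a 2) (a 3) * a 1 + quad_const h q (a 2) (a 3))"
proof -
  interpret h: coeff_hom h by fact
  have k: "h (lk q 2 0 0) * (h (x / lk q 2 0 0) * y) = h x * y" for x y
    using q(2) by (simp flip: h.hom_mult mult.assoc)
  show ?thesis
    unfolding h.eval_quadratic[OF q(1)] quad_lin_def quad_const_def distrib_left distrib_right k mult.assoc
    by (simp add: algebra_simps)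
qed

lemma eval_cubic_division:
  fixes h :: "'k::field \<Rightarrow> 'r::comm_ring_1"
  assumes h: "coeff_hom h" and p: "homogeneous 3 p"
  shows "eval_mpoly h a p = (h (lk p 3 0 0) * a 1 + quot_const h p q (a 2) (a 3)) *
      (a 1 ^ 2 + quad_lin h q (a 2) (a 3) * a 1 + quad_const h q (a 2) (a 3))
    + rem_lin h p q (a 2) (a 3) * a 1 + rem_const h p q (a 2) (a 3)"
  unfolding coeff_hom.eval_cubic[OF h p] quot_const_def rem_lin_def rem_const_def
  by (simp add: algebra_simps power2_eq_square power3_eq_cube)

text \<open>All these are binary forms, of degrees 1, 2, 1, 2, 3 and 6.\<close>

lemma rem_scale:
  "quad_lin h q (s * y) (s * z) = s * quad_lin h q y z"
  "quad_const h q (s * y) (s * z) = s ^ 2 * quad_const h q y z"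
  "quot_const h p q (s * y) (s * z) = s * quot_const h p q y z"
  "rem_lin h p q (s * y) (s * z) = s ^ 2 * rem_lin h p q y z"
  "rem_const h p q (s * y) (s * z) = s ^ 3 * rem_const h p q y z"
  "rem_norm h p q (s * y) (s * z) = s ^ 6 * rem_norm h p q y z"
proof -
  show 1: "quad_lin h q (s * y) (s * z) = s * quad_lin h q y z"
    and 2: "quad_const h q (s * y) (s * z) = s ^ 2 * quad_const h q y z"
    by (simp_all add: quad_lin_def quad_const_def algebra_simps power2_eq_square)
  show 3: "quot_const h p q (s * y) (s * z) = s * quot_const h p q y z"
    by (simp add: quot_const_def 1 algebra_simps)
  show 4: "rem_lin h p q (s * y) (s * z) = s ^ 2 * rem_lin h p q y z"
    by (simp add: rem_lin_def 1 2 3 algebra_simps power2_eq_square)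
  show 5: "rem_const h p q (s * y) (s * z) = s ^ 3 * rem_const h p q y z"
    by (simp add: rem_const_def 2 3 algebra_simps power2_eq_square power3_eq_cube)
  have "s ^ 6 = s * s * s * s * s * s" by (simp add: eval_nat_numeral)
  then show "rem_norm h p q (s * y) (s * z) = s ^ 6 * rem_norm h p q y z"
    unfolding rem_norm_def 1 2 4 5 by (simp add: algebra_simps power2_eq_square power3_eq_cube)
qed

lemma rem_hom:
  fixes h :: "'k::field \<Rightarrow> 'r::comm_ring_1" and E :: "'r \<Rightarrow> 's::comm_ring_1"
  assumes "coeff_hom E"
  shows "E (quad_lin h q y z) = quad_lin (\<lambda>c. E (h c)) q (E y) (E z)"
    "E (quad_const h q y z) = quad_const (\<lambda>c. E (h c)) q (E y) (E z)"
    "E (rem_lin h p q y z) = rem_lin (\<lambda>c. E (h c)) p q (E y) (E z)"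
    "E (rem_const h p q y z) = rem_const (\<lambda>c. E (h c)) p q (E y) (E z)"
    "E (rem_norm h p q y z) = rem_norm (\<lambda>c. E (h c)) p q (E y) (E z)"
proof -
  interpret E: coeff_hom E by fact
  show "E (quad_lin h q y z) = quad_lin (\<lambda>c. E (h c)) q (E y) (E z)"
    "E (quad_const h q y z) = quad_const (\<lambda>c. E (h c)) q (E y) (E z)"
    "E (rem_lin h p q y z) = rem_lin (\<lambda>c. E (h c)) p q (E y) (E z)"
    "E (rem_const h p q y z) = rem_const (\<lambda>c. E (h c)) p q (E y) (E z)"
    "E (rem_norm h p q y z) = rem_norm (\<lambda>c. E (h c)) p q (E y) (E z)"
    unfolding rem_defs by (simp_all add: E.hom_add E.hom_mult E.hom_diff E.hom_power)
qed

lemma univ_poly_rem: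
  "univ_poly (\<lambda>t. rem_lin h p q t 1)" "univ_poly (\<lambda>t. rem_const h p q t 1)"
  "univ_poly (\<lambda>t. rem_norm h p q t 1)" "univ_poly (\<lambda>t. rem_norm h p q 1 t)"
  unfolding rem_defs by (intro univ_poly_intros)+

text \<open>If R(t,1) has no root it is a constant c, so R(1,t) = c t^d for nonzero t and hence for
  t = 0, which makes (1,0) a zero.\<close>

lemma binary_form_zero:
  fixes R :: "'K::{alg_closed_field, field_char_0} \<Rightarrow> 'K \<Rightarrow> 'K"
  assumes scale: "\<And>s y z. R (s * y) (s * z) = s ^ d * R y z" and "d > 0"
    and poly: "univ_poly (\<lambda>t. R t 1)" "univ_poly (\<lambda>t. R 1 t)"
  shows "\<exists>y z. (y \<noteq> 0 \<or> z \<noteq> 0) \<and> R y z = 0"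
proof (rule ccontr)
  assume "\<not> ?thesis"
  then have nz: "R y z \<noteq> 0" if "y \<noteq> 0 \<or> z \<noteq> 0" for y z using that by blast
  obtain r where r: "\<And>t. poly r t = R t 1" using poly(1) unfolding univ_poly_def by blast
  have "degree r = 0"
    using alg_closed_imp_poly_has_root[of r] nz[of _ 1] r by fastforce
  then obtain c where "r = [:c:]" by (rule degree_eq_zeroE)
  then have c: "R t 1 = c" for t using r[of t] by simp
  have "R 1 t - c * t ^ d = 0" if "t \<noteq> 0" for t
    using scale[of t "1 / t" 1] c[of "1 / t"] that by simp
  moreover have "univ_poly (\<lambda>t. R 1 t - c * t ^ d)" by (intro univ_poly_intros poly)
  ultimately have "R 1 0 - c * 0 ^ d = 0" by (rule univ_poly_eq_0_at_0[rotated])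
  with nz[of 1 0] \<open>d > 0\<close> show False by simp
qed

section \<open>Common factors from a vanishing resultant\<close>

text \<open>
  The polynomials \<open>g\<close> with \<open>a dvd g b\<close> form an ideal that is stable under multiplication by \<open>b/a\<close>;
  hence its generator divides its own multiple by \<open>b/a\<close>.
\<close>

lemma dvd_of_quadratic_relation:
  fixes a b c d :: "'k::field poly"
  assumes "b ^ 2 - d * a * b + c * a ^ 2 = 0" and "a \<noteq> 0"
  shows "a dvd b"
proof -
  obtain g where g: "g \<noteq> 0" "a dvd g * b"
    and min: "\<And>g'. g' \<noteq> 0 \<Longrightarrow> a dvd g' * b \<Longrightarrow> degree g \<le> degree g'"
    using exists_least_iff[of "\<lambda>n. \<exists>g. degree g = n \<and> g \<noteq> 0 \<and> a dvd g * b"] \<open>a \<noteq> 0\<close>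
    by (metis dvd_triv_left leI)
  from g(2) obtain k where k: "g * b = a * k" by blast
  have "a * (k * b) = a * (a * (d * k - c * g))"
  proof -
    have "a * (k * b) = g * b ^ 2" by (simp add: power2_eq_square mult.assoc[symmetric] k)
    also have "b ^ 2 = d * a * b - c * a ^ 2" using assms(1) by (simp add: algebra_simps)
    also have "g * (d * a * b - c * a ^ 2) = a * (d * (g * b) - c * g * a)"
      by (simp add: algebra_simps power2_eq_square)
    also have "\<dots> = a * (a * (d * k - c * g))" unfolding k by (simp add: algebra_simps)
    finally show ?thesis .
  qed
  then have "k * b = a * (d * k - c * g)" using \<open>a \<noteq> 0\<close> by simp
  then have "a dvd k * b" by simp
  have "k mod g = 0"
  proof (rule ccontr)
    assume "k mod g \<noteq> 0"
    have "k mod g * b = k * b - (k div g) * (g * b)"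
      by (simp add: minus_div_mult_eq_mod[symmetric] algebra_simps)
    then have "a dvd k mod g * b" using \<open>a dvd k * b\<close> g(2) by simp
    with \<open>k mod g \<noteq> 0\<close> have "degree g \<le> degree (k mod g)" by (rule min)
    with degree_mod_less[of g k] g(1) \<open>k mod g \<noteq> 0\<close> show False by auto
  qed
  then obtain w where "k = g * w" by (auto elim: dvdE)
  with k g(1) have "b = a * w" by (simp add: mult.left_commute)
  then show ?thesis by simp
qed

text \<open>If u had degree at least 2, the degree of u^2 would exceed that of the other
  terms.\<close>

lemma monic_quadratic_root_linear:
  fixes u :: "'k::field poly"
  assumes "u ^ 2 + [:b2, b1:] * u + [:c3, c2, c1:] = 0"
  shows "degree u \<le> 1"
proof (rule ccontr)
  assume "\<not> degree u \<le> 1"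
  then have u: "degree u \<ge> 2" by simp
  have "degree ([:b2, b1:] * u + [:c3, c2, c1:]) \<le> degree u + 1"
    using u degree_mult_le[of "[:b2, b1:]" u] by (intro degree_add_le) (auto split: if_splits)
  moreover have "u ^ 2 = - ([:b2, b1:] * u + [:c3, c2, c1:])"
    using assms unfolding add.assoc by (rule iffD2[OF eq_neg_iff_add_eq_0])
  then have "degree (u ^ 2) = degree ([:b2, b1:] * u + [:c3, c2, c1:])" by (metis degree_minus)
  moreover have "degree (u ^ 2) = 2 * degree u" by (rule degree_power_eq) (use u in auto)
  ultimately show False using u by simp
qed

text \<open>Vanishing of the resultant says that \<open>- \<beta> / \<alpha>\<close> is a root of
  the monic quadratic. It is integral, hence a linear form \<open>U\<close>, and x1 - U divides both
  \<open>q\<close> and the remainder \<open>\<alpha> * (x1 - U)\<close> of \<open>p\<close>.\<close>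

lemma common_factor_of_rem_norm_eq_0:
  fixes p q :: "('k::field_char_0, 3) mpoly"
  assumes q: "homogeneous 2 q" "lk q 2 0 0 \<noteq> 0" and p: "homogeneous 3 p"
    and ndvd: "\<not> q dvd p" and zero: "\<And>t. rem_norm (\<lambda>c. c) p q t 1 = 0"
  shows "\<not> relatively_prime p q"
proof -
  let ?k = "lk q 2 0 0"
  let ?X = "Var 1 :: ('k, 3) mpoly" and ?Y = "Var 2 :: ('k, 3) mpoly" and ?Z = "Var 3 :: ('k, 3) mpoly"
  define b c e \<alpha> \<beta> where "b = quad_lin Const q ?Y ?Z" and "c = quad_const Const q ?Y ?Z"
    and "e = Const (lk p 3 0 0) * ?X + quot_const Const p q ?Y ?Z"
    and "\<alpha> = rem_lin Const p q ?Y ?Z" and "\<beta> = rem_const Const p q ?Y ?Z"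
  have q_eq: "q = Const ?k * (?X ^ 2 + b * ?X + c)"
    using eval_quadric_monic[OF coeff_hom_Const q, of Var] by (simp add: eval_Const_Var b_def c_def)
  have p_eq: "p = e * (?X ^ 2 + b * ?X + c) + \<alpha> * ?X + \<beta>"
    using eval_cubic_division[OF coeff_hom_Const p, of Var q]
    by (simp add: eval_Const_Var b_def c_def e_def \<alpha>_def \<beta>_def)
  have ev: "ev v b = quad_lin (\<lambda>c. c) q (v $ 2) (v $ 3)" "ev v c = quad_const (\<lambda>c. c) q (v $ 2) (v $ 3)"
    "ev v \<alpha> = rem_lin (\<lambda>c. c) p q (v $ 2) (v $ 3)" "ev v \<beta> = rem_const (\<lambda>c. c) p q (v $ 2) (v $ 3)" for v
    by (simp_all add: b_def c_def \<alpha>_def \<beta>_def rem_hom[OF coeff_hom_ev] ev_simps)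
  obtain A where A: "\<And>t. poly A t = rem_lin (\<lambda>c. c) p q t 1"
    using univ_poly_rem(1) unfolding univ_poly_def by blast
  obtain B where B: "\<And>t. poly B t = rem_const (\<lambda>c. c) p q t 1"
    using univ_poly_rem(2) unfolding univ_poly_def by blast
  \<comment> \<open>\<open>A\<close>, \<open>B\<close>, \<open>bp\<close>, \<open>cp\<close> are the
    binary forms dehomogenized at x3 = 1.\<close>
  define bp cp where "bp = [:lk q 1 0 1 / ?k, lk q 1 1 0 / ?k:]"
    and "cp = [:lk q 0 0 2 / ?k, lk q 0 1 1 / ?k, lk q 0 2 0 / ?k:]"
  have bp: "poly bp t = quad_lin (\<lambda>c. c) q t 1" and cp: "poly cp t = quad_const (\<lambda>c. c) q t 1" for t
    by (simp_all add: bp_def cp_def quad_lin_def quad_const_def power2_eq_square algebra_simps)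
  have "poly (B ^ 2 - bp * A * B + cp * A ^ 2) t = 0" for t
    using zero[of t] by (simp add: A B bp cp rem_norm_def)
  then have rel: "B ^ 2 - bp * A * B + cp * A ^ 2 = 0" by (intro iffD1[OF poly_all_0_iff_0] allI)
  have scale: "rem_lin (\<lambda>c. c) p q y z = z ^ 2 * poly A (y / z)"
    "rem_const (\<lambda>c. c) p q y z = z ^ 3 * poly B (y / z)" if "z \<noteq> 0" for y z
    using rem_scale(4)[of "\<lambda>c. c" p q z "y / z" 1] rem_scale(5)[of "\<lambda>c. c" p q z "y / z" 1] that
    by (simp_all add: A B)
  have "A \<noteq> 0"
  proof
    assume "A = 0"
    with rel have "B = 0" by simp
    have "\<alpha> = 0" "\<beta> = 0"
      using \<open>A = 0\<close> \<open>B = 0\<close> by (auto intro!: mpoly3_eq_0I simp: ev scale)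
    have "Const ?k * Const (1 / ?k) = (1 :: ('k, 3) mpoly)"
      using q(2) by (simp add: cn.hom_one flip: cn.hom_mult)
    then have "p = (Const ?k * Const (1 / ?k)) * (e * (?X ^ 2 + b * ?X + c))"
      using p_eq \<open>\<alpha> = 0\<close> \<open>\<beta> = 0\<close> by simp
    also have "\<dots> = Const ?k * (?X ^ 2 + b * ?X + c) * (Const (1 / ?k) * e)" by (simp only: ac_simps)
    also have "\<dots> = q * (Const (1 / ?k) * e)" unfolding q_eq[symmetric] ..
    finally have "q dvd p" by simp
    with ndvd show False ..
  qed
  have "A dvd B" using rel \<open>A \<noteq> 0\<close> by (rule dvd_of_quadratic_relation)
  then obtain w where "B = A * w" by blast
  then have "B = - (A * (- w))" by simp
  then obtain u where u: "B = - (A * u)" by blast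
  have "A ^ 2 * (u ^ 2 + bp * u + cp) = 0"
    using rel unfolding u by (simp add: algebra_simps power2_eq_square)
  with \<open>A \<noteq> 0\<close> have u_root: "u ^ 2 + bp * u + cp = 0" by simp
  then have "degree u \<le> 1" unfolding bp_def cp_def by (rule monic_quadratic_root_linear)
  define u1 u0 where "u1 = coeff u 1" and "u0 = coeff u 0"
  have "u = [:u0, u1:]"
    using \<open>degree u \<le> 1\<close>
    by (intro poly_eqI) (auto simp: u0_def u1_def coeff_pCons coeff_eq_0 split: nat.split)
  \<comment> \<open>The homogenization of \<open>u\<close>, possible because its degree is at most
    1.\<close>
  define U where "U = Const u1 * ?Y + Const u0 * ?Z"
  have U: "ev v U = v $ 3 * poly u (v $ 2 / v $ 3)" if "v $ 3 \<noteq> 0" for v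
    using that by (simp add: U_def ev_simps \<open>u = [:u0, u1:]\<close> field_simps)
  have "\<beta> = - (\<alpha> * U)"
  proof -
    have "\<beta> + \<alpha> * U = 0"
      by (rule mpoly3_eq_0I) (simp add: ev_simps ev scale U u power2_eq_square power3_eq_cube)
    then show ?thesis by (simp add: eq_neg_iff_add_eq_0)
  qed
  have "U ^ 2 + b * U + c = 0"
  proof (rule mpoly3_eq_0I)
    fix v :: "'k ^ 3" assume "\<forall>i. v $ i \<noteq> 0"
    then have z: "v $ 3 \<noteq> 0" by simp
    have "poly (u ^ 2 + bp * u + cp) (v $ 2 / v $ 3) = 0" unfolding u_root by simp
    moreover have "ev v (U ^ 2 + b * U + c) = (v $ 3) ^ 2 * poly (u ^ 2 + bp * u + cp) (v $ 2 / v $ 3)"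
      using z rem_scale(1)[of "\<lambda>c. c" q "v $ 3" "v $ 2 / v $ 3" 1]
        rem_scale(2)[of "\<lambda>c. c" q "v $ 3" "v $ 2 / v $ 3" 1]
      by (simp add: ev_simps ev U bp cp algebra_simps power2_eq_square)
    ultimately show "ev v (U ^ 2 + b * U + c) = 0" by simp
  qed
  then have c: "c = - (U ^ 2) - b * U" by (simp add: algebra_simps eq_neg_iff_add_eq_0)
  have fact: "?X ^ 2 + b * ?X + c = (?X - U) * (?X + U + b)"
    unfolding c by (simp add: algebra_simps power2_eq_square)
  have "q = (?X - U) * (Const ?k * (?X + U + b))"
    by (subst q_eq) (simp add: fact mult.left_commute)
  moreover have "p = e * ((?X - U) * (?X + U + b)) + \<alpha> * ?X + - (\<alpha> * U)"
    using p_eq unfolding fact \<open>\<beta> = - (\<alpha> * U)\<close> .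
  then have "p = (?X - U) * (e * (?X + U + b) + \<alpha>)" by (simp add: algebra_simps)
  ultimately have "?X - U dvd q" "?X - U dvd p" by (metis dvd_triv_left)+
  moreover have "\<not> ?X - U dvd 1"
  proof
    assume "?X - U dvd 1"
    then obtain r where "1 = (?X - U) * r" by blast
    \<comment> \<open>A linear form vanishes at the origin, so it is not a unit.\<close>
    then have "ev 0 1 = ev 0 ((?X - U) * r)" by (rule arg_cong)
    then show False by (simp add: U_def ev_simps)
  qed
  ultimately show ?thesis unfolding relatively_prime_def by blast
qed

section \<open>Projective zeros over the algebraic closure\<close>

lemma proj_point_scale:
  assumes "(c :: 'K::field) \<noteq> 0"
  shows "proj_point (c *s v) = proj_point v"
proof (intro subset_antisym subsetI)
  fix w assume "w \<in> proj_point (c *s v)"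
  then obtain d where "w = d *s (c *s v)" "d \<noteq> 0" unfolding proj_point_def by blast
  then have "w = (d * c) *s v \<and> d * c \<noteq> 0" using assms by (simp add: vector_smult_assoc)
  then show "w \<in> proj_point v" unfolding proj_point_def by blast
next
  fix w assume "w \<in> proj_point v"
  then obtain d where "w = d *s v" "d \<noteq> 0" unfolding proj_point_def by blast
  then have "w = (d / c) *s (c *s v) \<and> d / c \<noteq> 0" using assms by (simp add: vector_smult_assoc)
  then show "w \<in> proj_point (c *s v)" unfolding proj_point_def by blast
qed

text \<open>A zero of the resultant lifts to a common zero by choosing the right root of the
  quadratic. Conversely, common zeros lie over zeros of the resultant or on x3 = 0, with at most two
  over each point (y:z).\<close>

lemma vanishing_locus_quadric_cubic:
  fixes p q :: "('k::field_char_0, 3) mpoly"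
  assumes q: "homogeneous 2 q" "lk q 2 0 0 \<noteq> 0" and p: "homogeneous 3 p"
  shows "vanishing_locus {p, q} \<noteq> {}"
    and "rem_norm (\<lambda>c. c) p q t 1 \<noteq> 0 \<Longrightarrow> finite (vanishing_locus {p, q})"
proof -
  define b c \<alpha> \<beta> R where "b = quad_lin to_ac q" and "c = quad_const to_ac q"
    and "\<alpha> = rem_lin to_ac p q" and "\<beta> = rem_const to_ac p q" and "R = rem_norm to_ac p q"
  have R: "R y z = \<beta> y z ^ 2 - b y z * \<alpha> y z * \<beta> y z + c y z * \<alpha> y z ^ 2" for y z
    by (simp add: R_def b_def c_def \<alpha>_def \<beta>_def rem_norm_def)
  have zero_iff: "(\<forall>f\<in>{p, q}. eval_mpoly to_ac (\<lambda>i. v $ i) f = 0) \<longleftrightarrow>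
    (v $ 1) ^ 2 + b (v $ 2) (v $ 3) * v $ 1 + c (v $ 2) (v $ 3) = 0 \<and>
    \<alpha> (v $ 2) (v $ 3) * v $ 1 + \<beta> (v $ 2) (v $ 3) = 0" for v
    using q(2) unfolding b_def c_def \<alpha>_def \<beta>_def
    by (auto simp: eval_quadric_monic[OF coeff_hom_to_ac q] eval_cubic_division[OF coeff_hom_to_ac p, of _ q])
  show "vanishing_locus {p, q} \<noteq> {}"
  proof -
    have "\<exists>y z. (y \<noteq> 0 \<or> z \<noteq> 0) \<and> R y z = 0"
      unfolding R_def by (rule binary_form_zero, rule rem_scale(6), simp, (rule univ_poly_rem)+)
    then obtain y z where yz: "y \<noteq> 0 \<or> z \<noteq> 0" "R y z = 0" by blast
    obtain \<xi> where "poly [:c y z, b y z, 1:] \<xi> = 0"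
      using alg_closed_imp_poly_has_root[of "[:c y z, b y z, 1:]"] by auto
    then have \<xi>: "c y z = - (\<xi> ^ 2 + b y z * \<xi>)" by (simp add: algebra_simps power2_eq_square eq_neg_iff_add_eq_0)
    \<comment> \<open>The resultant is the product of the remainder's values at the two roots
      \<open>\<xi>\<close> and \<open>- b y z - \<xi>\<close>.\<close>
    have "(\<alpha> y z * \<xi> + \<beta> y z) * (\<alpha> y z * (- b y z - \<xi>) + \<beta> y z) = R y z"
      unfolding R \<xi> by (simp add: algebra_simps power2_eq_square)
    then have "\<alpha> y z * \<xi> + \<beta> y z = 0 \<or> \<alpha> y z * (- b y z - \<xi>) + \<beta> y z = 0"
      using yz(2) by auto
    moreover have "\<xi> ^ 2 + b y z * \<xi> + c y z = 0" "(- b y z - \<xi>) ^ 2 + b y z * (- b y z - \<xi>) + c y z = 0"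
      unfolding \<xi> by (simp_all add: algebra_simps power2_eq_square)
    ultimately obtain x where x: "x ^ 2 + b y z * x + c y z = 0" "\<alpha> y z * x + \<beta> y z = 0"
      by blast
    have "vector [x, y, z] \<noteq> (0 :: 'k alg_closure ^ 3)" using yz(1) by (auto simp: vec_eq_iff forall_3)
    moreover have "\<forall>f\<in>{p, q}. eval_mpoly to_ac (\<lambda>i. vector [x, y, z] $ i) f = 0"
      unfolding zero_iff using x by simp
    ultimately show ?thesis unfolding vanishing_locus_def by blast
  qed
  assume t: "rem_norm (\<lambda>c. c) p q t 1 \<noteq> 0"
  obtain r where r: "\<And>t. poly r t = R t 1"
    using univ_poly_rem(3) unfolding univ_poly_def R_def by blast
  have "R (to_ac t) 1 = to_ac (rem_norm (\<lambda>c. c) p q t 1)"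
    using rem_hom(5)[OF coeff_hom_to_ac, of "\<lambda>c. c" p q t 1] by (simp add: R_def)
  with t r[of "to_ac t"] have "r \<noteq> 0" by auto
  have root: "poly [:c y z, b y z, 1:] x = 0" if "x ^ 2 + b y z * x + c y z = 0" for x y z
    using that by (simp add: algebra_simps power2_eq_square)
  have affine: "poly r y = 0" if 1: "x ^ 2 + b y 1 * x + c y 1 = 0" and 2: "\<alpha> y 1 * x + \<beta> y 1 = 0" for x y
  proof -
    from 1 have "c y 1 + (x ^ 2 + b y 1 * x) = 0" by (simp only: add.commute)
    then have c: "c y 1 = - (x ^ 2 + b y 1 * x)" by (simp only: eq_neg_iff_add_eq_0)
    have "R y 1 = (\<alpha> y 1 * x + \<beta> y 1) * (\<alpha> y 1 * (- b y 1 - x) + \<beta> y 1)"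
      unfolding R c by (simp add: algebra_simps power2_eq_square)
    then show ?thesis unfolding r 2 by simp
  qed
  \<comment> \<open>Representatives are normalized to x3 = 1 in \<open>?S\<close>, and to x2 = 1, x3
    = 0 in \<open>?S'\<close>.\<close>
  let ?S = "SIGMA y:{y. poly r y = 0}. {x. poly [:c y 1, b y 1, 1:] x = 0}"
  let ?S' = "{x. poly [:c 1 0, b 1 0, 1:] x = 0}"
  let ?Z = "(\<lambda>(y, x). proj_point (vector [x, y, 1])) ` ?S \<union> (\<lambda>x. proj_point (vector [x, 1, 0])) ` ?S'"
  have "finite ?Z"
    using \<open>r \<noteq> 0\<close> by (intro finite_UnI finite_imageI finite_SigmaI poly_roots_finite) simp_all
  moreover have "vanishing_locus {p, q} \<subseteq> ?Z"
  proof
    fix Pt assume "Pt \<in> vanishing_locus {p, q}"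
    then obtain v where v: "Pt = proj_point v" "v \<noteq> 0"
      and zv: "\<forall>f\<in>{p, q}. eval_mpoly to_ac (\<lambda>i. v $ i) f = 0"
      unfolding vanishing_locus_def by blast
    have zs: "\<forall>f\<in>{p, q}. eval_mpoly to_ac (\<lambda>i. (s *s v) $ i) f = 0" for s
      using zv by (auto simp: ac.eval_homogeneous_scale[OF p] ac.eval_homogeneous_scale[OF q(1)])
    show "Pt \<in> ?Z"
    proof (cases "v $ 3 = 0")
      case False
      let ?w = "inverse (v $ 3) *s v"
      have w: "?w = vector [?w $ 1, ?w $ 2, 1]" using False by (simp add: vec_eq_iff forall_3)
      have Pt: "Pt = proj_point ?w" unfolding v(1) by (rule proj_point_scale[symmetric]) (use False in simp)
      have w3: "?w $ 3 = 1" using False by simp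
      note z = zs[of "inverse (v $ 3)", unfolded zero_iff w3]
      show ?thesis
      proof (rule UnI1, rule image_eqI)
        show "Pt = (\<lambda>(y, x). proj_point (vector [x, y, 1])) (?w $ 2, ?w $ 1)"
          unfolding prod.case Pt by (rule arg_cong[OF w])
        show "(?w $ 2, ?w $ 1) \<in> ?S"
          using affine[OF conjunct1[OF z] conjunct2[OF z]] root[OF conjunct1[OF z]]
          by (intro SigmaI CollectI)
      qed
    next
      case True
      \<comment> \<open>The point (1:0:0) is not a zero because the quadratic is monic in
        x1.\<close>
      have "v $ 2 \<noteq> 0"
      proof
        assume y: "v $ 2 = 0"
        have "b 0 0 = 0" "c 0 0 = 0" by (simp_all add: b_def c_def quad_lin_def quad_const_def)
        with zv[unfolded zero_iff] True y have "v $ 1 = 0" by simp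
        with True y v(2) show False by (simp add: vec_eq_iff forall_3)
      qed
      let ?w = "inverse (v $ 2) *s v"
      have w: "?w = vector [?w $ 1, 1, 0]" using True \<open>v $ 2 \<noteq> 0\<close> by (simp add: vec_eq_iff forall_3)
      have Pt: "Pt = proj_point ?w" unfolding v(1) by (rule proj_point_scale[symmetric]) (use \<open>v $ 2 \<noteq> 0\<close> in simp)
      have w23: "?w $ 2 = 1" "?w $ 3 = 0" using True \<open>v $ 2 \<noteq> 0\<close> by simp_all
      have "poly [:c 1 0, b 1 0, 1:] (?w $ 1) = 0"
        by (rule root[OF conjunct1[OF zs[of "inverse (v $ 2)", unfolded zero_iff w23]]])
      then have "?w $ 1 \<in> ?S'" by (rule CollectI)
      moreover have "Pt = proj_point (vector [?w $ 1, 1, 0])"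
        unfolding Pt by (rule arg_cong[OF w])
      ultimately show ?thesis by (intro UnI2 image_eqI)
    qed
  qed
  ultimately show "finite (vanishing_locus {p, q})" by (rule finite_subset[rotated])
qed

section \<open>Invariance under linear changes of coordinates\<close>

lemma lin_act_lin_act:
  fixes f :: "('k::field_char_0, 3) mpoly"
  assumes "N ** A = mat 1"
  shows "lin_act N (lin_act A f) = f"
  by (rule mpoly3_eqI) (simp add: ev_lin_act vector_matrix_mul_assoc assms)

lemma lin_act_mult: "lin_act A (f * g) = lin_act A f * lin_act A g"
  by (simp add: lin_act_def cn.eval_mpoly_mult)

lemma lin_act_one: "lin_act A 1 = 1"
  by (simp add: lin_act_def cn.eval_mpoly_one)

lemma lin_act_dvd: "f dvd g \<Longrightarrow> lin_act A f dvd lin_act A g"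
  by (auto simp: dvd_def lin_act_mult)

lemma vector_matrix_mult_scale: "(c *s v) v* A = c *s (v v* (A :: 'a::field ^ 'n ^ 'm))"
  by (simp add: vec_eq_iff vector_matrix_mult_def sum_distrib_left mult.assoc)

lemma proj_point_vector_matrix_mult: "(\<lambda>v. v v* A) ` proj_point v = proj_point (v v* A)"
  unfolding proj_point_def by (force simp: vector_matrix_mult_scale)

text \<open>Multiplication by \<open>A\<close> sends zeros of the substituted forms to zeros of the
  original ones; the inverse matrix, mapped into the closure, sends them back.\<close>

lemma vanishing_locus_lin_act:
  fixes F :: "('k::field_char_0, 3) mpoly set"
  assumes "invertible A"
  shows "vanishing_locus F = (\<lambda>Z. (\<lambda>v. v v* (\<chi> i j. to_ac (A $ i $ j))) ` Z) ` vanishing_locus (lin_act A ` F)"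
proof -
  obtain N where N: "A ** N = mat 1" "N ** A = mat 1" using assms unfolding invertible_def by blast
  let ?M = "\<chi> i j. to_ac (A $ i $ j)" and ?N = "\<chi> i j. to_ac (N $ i $ j)"
  have map_mult: "(\<chi> i j. to_ac (B $ i $ j)) ** (\<chi> i j. to_ac (C $ i $ j)) = mat 1"
    if "B ** C = mat 1" for B C :: "'k ^ 3 ^ 3"
  proof -
    have "(\<Sum>k\<in>UNIV. to_ac (B $ i $ k) * to_ac (C $ k $ j)) = to_ac ((B ** C) $ i $ j)" for i j
      by (simp add: matrix_matrix_mult_def to_ac_sum)
    then show ?thesis unfolding that by (simp add: vec_eq_iff matrix_matrix_mult_def mat_def)
  qed
  have ev: "eval_mpoly to_ac (\<lambda>i. v $ i) (lin_act A f) = eval_mpoly to_ac (\<lambda>i. (v v* ?M) $ i) f" for v f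
    by (simp add: ac.eval_lin_act vector_matrix_mult_def mult.commute)
  have cancel: "v v* ?N v* ?M = v" for v
    by (simp add: vector_matrix_mul_assoc map_mult[OF N(2)])
  have cancel': "v v* ?M v* ?N = v" for v
    by (simp add: vector_matrix_mul_assoc map_mult[OF N(1)])
  show ?thesis
  proof (intro subset_antisym subsetI)
    fix Z assume "Z \<in> vanishing_locus F"
    then obtain v where v: "Z = proj_point v" "v \<noteq> 0" "\<forall>f\<in>F. eval_mpoly to_ac (\<lambda>i. v $ i) f = 0"
      unfolding vanishing_locus_def by blast
    let ?w = "v v* ?N"
    have "?w \<noteq> 0" using cancel[of v] v(2) by (metis vector_matrix_mult_0)
    moreover have "\<forall>f\<in>lin_act A ` F. eval_mpoly to_ac (\<lambda>i. ?w $ i) f = 0"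
      using v(3) by (simp add: ev cancel)
    ultimately have "proj_point ?w \<in> vanishing_locus (lin_act A ` F)"
      unfolding vanishing_locus_def by blast
    moreover have "Z = (\<lambda>v. v v* ?M) ` proj_point ?w"
      unfolding proj_point_vector_matrix_mult cancel by (rule v(1))
    ultimately show "Z \<in> (\<lambda>Z. (\<lambda>v. v v* ?M) ` Z) ` vanishing_locus (lin_act A ` F)"
      by (rule image_eqI[rotated])
  next
    fix Z assume "Z \<in> (\<lambda>Z. (\<lambda>v. v v* ?M) ` Z) ` vanishing_locus (lin_act A ` F)"
    then obtain w where w: "Z = (\<lambda>v. v v* ?M) ` proj_point w" "w \<noteq> 0"
      "\<forall>f\<in>lin_act A ` F. eval_mpoly to_ac (\<lambda>i. w $ i) f = 0"
      unfolding vanishing_locus_def by blast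
    have "w v* ?M \<noteq> 0" using cancel'[of w] w(2) by (metis vector_matrix_mult_0)
    moreover have "\<forall>f\<in>F. eval_mpoly to_ac (\<lambda>i. (w v* ?M) $ i) f = 0"
      using w(3) by (simp add: ev)
    moreover have "Z = proj_point (w v* ?M)" unfolding w(1) proj_point_vector_matrix_mult ..
    ultimately show "Z \<in> vanishing_locus F" unfolding vanishing_locus_def by blast
  qed
qed

lemma ex_invertible_first_row:
  fixes a :: "'k::field ^ 3"
  assumes "a \<noteq> 0"
  obtains A :: "'k ^ 3 ^ 3" where "invertible A" "A $ 1 = a"
proof -
  obtain i where i: "a $ i \<noteq> 0" using assms by (auto simp: vec_eq_iff)
  consider "i = 1" | "i = 2" | "i = 3" using exhaust_3 by blast
  then show ?thesis
  proof cases
    case 1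
    show ?thesis
      by (rule that[of "vector [a, axis 2 1, axis 3 1]"])
        (use i 1 in \<open>simp_all add: invertible_det_nz det_3 axis_def\<close>)
  next
    case 2
    show ?thesis
      by (rule that[of "vector [a, axis 1 1, axis 3 1]"])
        (use i 2 in \<open>simp_all add: invertible_det_nz det_3 axis_def\<close>)
  next
    case 3
    show ?thesis
      by (rule that[of "vector [a, axis 1 1, axis 2 1]"])
        (use i 3 in \<open>simp_all add: invertible_det_nz det_3 axis_def\<close>)
  qed
qed

text \<open>Moving a point with \<open>ev a q\<close> nonzero to (1,0,0) makes the x1^2 coefficient
  of \<open>q\<close> nonzero; indivisibility and relative primality transfer through the inverse
  substitution.\<close>

lemma quadric_cubic_finite_nonempty:
  fixes p q :: "('k::field_char_0, 3) mpoly"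
  assumes q: "homogeneous 2 q" "q \<noteq> 0" and p: "homogeneous 3 p"
    and ndvd: "\<not> q dvd p" and cop: "relatively_prime p q"
  shows "finite (vanishing_locus {p, q})" "vanishing_locus {p, q} \<noteq> {}"
proof -
  obtain a where a: "ev a q \<noteq> 0" using mpoly3_eq_0I[of q] q(2) by blast
  have "a \<noteq> 0"
  proof
    assume "a = 0"
    then have "ev a q = 0" using ev_homogeneous_scale[OF q(1), of 0 0] by simp
    with a show False by simp
  qed
  then obtain A :: "'k ^ 3 ^ 3" where A: "invertible A" "A $ 1 = a" by (rule ex_invertible_first_row)
  obtain N where N: "N ** A = mat 1" using A(1) unfolding invertible_def by blast
  then have N': "A ** N = mat 1" by (simp add: matrix_left_right_inverse)
  let ?p = "lin_act A p" and ?q = "lin_act A q"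
  have hom: "homogeneous 2 ?q" "homogeneous 3 ?p" by (rule homogeneous_lin_act, fact)+
  have "lk ?q 2 0 0 = ev (vector [1, 0, 0]) ?q" by (simp add: ev_quadratic[OF hom(1)])
  also have "\<dots> = ev a q" by (simp only: ev_vector3_lin_act A(2)) simp
  finally have k: "lk ?q 2 0 0 \<noteq> 0" using a by simp
  have "\<not> ?q dvd ?p"
    using ndvd lin_act_dvd[of ?q ?p N] by (auto simp: lin_act_lin_act[OF N])
  moreover have "relatively_prime ?p ?q"
    unfolding relatively_prime_def
  proof (intro allI impI)
    fix c assume "c dvd ?p" "c dvd ?q"
    then have "lin_act N c dvd p" "lin_act N c dvd q"
      using lin_act_dvd[of c _ N] lin_act_lin_act[OF N] by metis+
    then have "lin_act N c dvd 1" using cop unfolding relatively_prime_def by blast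
    then show "c dvd 1" using lin_act_dvd[of "lin_act N c" 1 A] by (simp add: lin_act_lin_act[OF N'] lin_act_one)
  qed
  ultimately obtain t where "rem_norm (\<lambda>c. c) ?p ?q t 1 \<noteq> 0"
    using common_factor_of_rem_norm_eq_0[OF hom(1) k hom(2)] by blast
  then have "finite (vanishing_locus {?p, ?q})"
    by (rule vanishing_locus_quadric_cubic(2)[OF hom(1) k hom(2)])
  then show "finite (vanishing_locus {p, q})"
    unfolding vanishing_locus_lin_act[OF A(1), of "{p, q}"] by simp
  show "vanishing_locus {p, q} \<noteq> {}"
    using vanishing_locus_quadric_cubic(1)[OF hom(1) k hom(2)]
    unfolding vanishing_locus_lin_act[OF A(1), of "{p, q}"] by simp
qed

section \<open>Vanishing loci\<close>

lemma vanishing_locus_span: "vanishing_locus (mpoly.span S) = vanishing_locus S"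
  unfolding vanishing_locus_def eval_vanish_span[OF coeff_hom_to_ac] ..

text \<open>A nonzero point has a nonzero coordinate, so the three multiples vanish there only if
  \<open>q\<close> does.\<close>

lemma vanishing_locus_quadric_multiples:
  "vanishing_locus {Var 1 * q, Var 2 * q, Var 3 * q, p} = vanishing_locus {p, q}"
proof -
  have "(\<forall>f\<in>{Var 1 * q, Var 2 * q, Var 3 * q, p}. eval_mpoly to_ac (\<lambda>i. v $ i) f = 0)
    \<longleftrightarrow> (\<forall>f\<in>{p, q}. eval_mpoly to_ac (\<lambda>i. v $ i) f = 0)" if "v \<noteq> 0" for v :: "'a alg_closure ^ 3"
    using that by (auto simp: ac.eval_simps vec_eq_iff forall_3)
  then show ?thesis unfolding vanishing_locus_def by blast
qed

text \<open>The product x1 x2 x3 kills one coordinate, and the other cubics then kill a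
  second.\<close>

lemma vanishing_locus_three_points:
  "vanishing_locus {Var 1 * (Var 2 ^ 2 + Var 3 ^ 2), Var 2 * (Var 1 ^ 2 + Var 3 ^ 2),
      Var 3 * (Var 1 ^ 2 + Var 2 ^ 2), Var 1 * Var 2 * Var 3 :: ('k::field, 3) mpoly}
    = {proj_point (vector [1, 0, 0]), proj_point (vector [0, 1, 0]), proj_point (vector [0, 0, 1])}"
    (is "vanishing_locus ?T = ?Z")
proof -
  have iff: "(\<forall>f\<in>?T. eval_mpoly to_ac (\<lambda>i. v $ i) f = 0) \<longleftrightarrow>
    v $ 1 = 0 \<and> v $ 2 = 0 \<or> v $ 1 = 0 \<and> v $ 3 = 0 \<or> v $ 2 = 0 \<and> v $ 3 = 0"
    for v :: "'k alg_closure ^ 3"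
    by (auto simp: ac.eval_simps)
  show ?thesis
  proof (intro subset_antisym subsetI)
    fix Z assume "Z \<in> vanishing_locus ?T"
    then obtain v where v: "Z = proj_point v" "v \<noteq> 0"
      and "\<forall>f\<in>?T. eval_mpoly to_ac (\<lambda>i. v $ i) f = 0"
      unfolding vanishing_locus_def by blast
    then consider "v $ 2 = 0" "v $ 3 = 0" | "v $ 1 = 0" "v $ 3 = 0" | "v $ 1 = 0" "v $ 2 = 0"
      unfolding iff by blast
    then show "Z \<in> ?Z"
    proof cases
      case 1
      then have "v = v $ 1 *s vector [1, 0, 0]" "v $ 1 \<noteq> 0"
        using v(2) by (auto simp: vec_eq_iff forall_3)
      then have "Z = proj_point (vector [1, 0, 0])" using v(1) proj_point_scale by metis
      then show ?thesis by simp
    next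
      case 2
      then have "v = v $ 2 *s vector [0, 1, 0]" "v $ 2 \<noteq> 0"
        using v(2) by (auto simp: vec_eq_iff forall_3)
      then have "Z = proj_point (vector [0, 1, 0])" using v(1) proj_point_scale by metis
      then show ?thesis by simp
    next
      case 3
      then have "v = v $ 3 *s vector [0, 0, 1]" "v $ 3 \<noteq> 0"
        using v(2) by (auto simp: vec_eq_iff forall_3)
      then have "Z = proj_point (vector [0, 0, 1])" using v(1) proj_point_scale by metis
      then show ?thesis by simp
    qed
  next
    have mem: "proj_point v \<in> vanishing_locus ?T"
      if "v \<noteq> 0" "v $ 1 = 0 \<and> v $ 2 = 0 \<or> v $ 1 = 0 \<and> v $ 3 = 0 \<or> v $ 2 = 0 \<and> v $ 3 = 0"
      for v :: "'k alg_closure ^ 3"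
      using that unfolding vanishing_locus_def iff by blast
    fix Z assume "Z \<in> ?Z"
    then show "Z \<in> vanishing_locus ?T"
      by (elim insertE emptyE) (simp_all only:, (rule mem; simp add: vec_eq_iff forall_3)+)
  qed
qed

text \<open>The product kills one coordinate, the cyclic cubic then a second, and the sum of cubes
  the third.\<close>

lemma vanishing_locus_cyclic:
  "vanishing_locus {Var 1 ^ 3 + Var 2 ^ 3 + Var 3 ^ 3,
      Var 1 ^ 2 * Var 2 + Var 2 ^ 2 * Var 3 + Var 3 ^ 2 * Var 1,
      Var 1 * Var 2 ^ 2 + Var 2 * Var 3 ^ 2 + Var 3 * Var 1 ^ 2,
      Var 1 * Var 2 * Var 3 :: ('k::field, 3) mpoly} = {}"
    (is "vanishing_locus ?T = _")
proof -
  have "v = 0" if "\<forall>f\<in>?T. eval_mpoly to_ac (\<lambda>i. v $ i) f = 0" for v :: "'k alg_closure ^ 3"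
  proof -
    have "v $ 1 = 0 \<or> v $ 2 = 0 \<or> v $ 3 = 0"
      and "v $ 1 ^ 3 + v $ 2 ^ 3 + v $ 3 ^ 3 = 0"
      and "v $ 1 ^ 2 * v $ 2 + v $ 2 ^ 2 * v $ 3 + v $ 3 ^ 2 * v $ 1 = 0"
      using that by (simp_all add: ac.eval_simps)
    then have "v $ 1 = 0 \<and> v $ 2 = 0 \<and> v $ 3 = 0" by auto
    then show ?thesis by (simp add: vec_eq_iff forall_3)
  qed
  then show ?thesis unfolding vanishing_locus_def by blast
qed

theorem theorem2p7:
  shows "let G = mpoly.span {Var 1 ^ 3, Var 1 ^ 2 * Var 2, Var 1 * Var 2 ^ 2, Var 1 ^ 2 * Var 3}
           :: ('k::field_char_0, 3) mpoly set
    in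
      (\<forall>q p. homogeneous 2 q \<and> q \<noteq> 0 \<and> homogeneous 3 p \<and> \<not> q dvd p \<longrightarrow>
        (let V = mpoly.span {Var 1 * q, Var 2 * q, Var 3 * q, p} in
          has_gin V G \<and>
          (relatively_prime p q \<longrightarrow> is_complete_intersection (vanishing_locus V) p q)))
    \<and>
      (let V = mpoly.span
          {Var 1 * (Var 2 ^ 2 + Var 3 ^ 2), Var 2 * (Var 1 ^ 2 + Var 3 ^ 2), Var 3 * (Var 1 ^ 2 + Var 2 ^ 2),
           Var 1 * Var 2 * Var 3} in
        has_gin V G \<and>
        vanishing_locus V =
          {proj_point (vector [1, 0, 0]), proj_point (vector [0, 1, 0]),
           proj_point (vector [0, 0, 1])})
    \<and>
      (let V = mpoly.span
          {Var 1 ^ 3 + Var 2 ^ 3 + Var 3 ^ 3,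
           Var 1 ^ 2 * Var 2 + Var 2 ^ 2 * Var 3 + Var 3 ^ 2 * Var 1,
           Var 1 * Var 2 ^ 2 + Var 2 * Var 3 ^ 2 + Var 3 * Var 1 ^ 2,
           Var 1 * Var 2 * Var 3} in
        has_gin V G \<and> vanishing_locus V = {})"
  unfolding Let_def gin_cubics_eq[symmetric] vanishing_locus_span is_complete_intersection_def
    vanishing_locus_quadric_multiples vanishing_locus_three_points vanishing_locus_cyclic
  using has_gin_quadric_cubic quadric_cubic_finite_nonempty has_gin_three_points has_gin_cyclic
  by (intro conjI allI impI refl) blast+

end
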